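(* Let $1\le p\le\infty$, $\alpha>1$, $d\ge 1$, and let $W_\alpha(\mathbf{x}):=e^{-|\mathbf{x}|^\alpha}$ for $\mathbf{x}\in\mathbb{R}^d$. Suppose that $f:\mathbb{R}^d\to\mathbb{R}$ is convex on $\mathbb{R}^d$, and, in addition, $fW_\alpha\in L_p(\mathbb{R}^d)$ if $1\le p<\infty$, or $f\in C(\mathbb{R}^d)$ with $\lim_{|\mathbf{x}|\to\infty}f(\mathbf{x})W_\alpha(\mathbf{x})=0$ if $p=\infty$. Then \[ \inf_{P\in\Pi_{n,d}^{(2)}}\|(f-P)W_\alpha\|_{L_p(\mathbb{R}^d)}\to 0,\quad n\to\infty. \]
   Context: $|\mathbf{x}|=(x_1^2+\dots+x_d^2)^{1/2}$ is the Euclidean norm. $\Pi_{n,d}$ denotes the space of real algebraic polynomials of total degree $\le n$ in $d$ variables, and $\Pi_{n,d}^{(2)}$ denotes the set of polynomials in $\Pi_{n,d}$ that are convex on $\mathbb{R}^d$. $L_p(\mathbb{R}^d)$ has the usual norm ($\|g\|_{L_\infty}=\operatorname{ess\,sup}|g|$). *)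

theory Defs
  imports "HOL-Analysis.Analysis" "HOL-Probability.Probability"
begin

definition W :: "real \<Rightarrow> real ^ 'd \<Rightarrow> real" where
  "W \<alpha> x = exp (- (norm x powr \<alpha>))"

definition poly_space :: "nat \<Rightarrow> (real ^ 'd \<Rightarrow> real) set" where
  "poly_space n = {P. \<exists>c :: ('d \<Rightarrow> nat) \<Rightarrow> real.
      \<forall>x. P x = (\<Sum>a \<in> {a. sum a UNIV \<le> n}. c a * (\<Prod>i\<in>UNIV. (x $ i) ^ a i))}"

definition convex_poly_space :: "nat \<Rightarrow> (real ^ 'd \<Rightarrow> real) set" where
  "convex_poly_space n = {P \<in> poly_space n. convex_on UNIV P}"

definition ennpow :: "ennreal \<Rightarrow> real \<Rightarrow> ennreal" where
  "ennpow t q = (if t = \<infinity> then \<infinity> else ennreal (enn2real t powr q))"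

definition Lp_norm :: "ennreal \<Rightarrow> (real ^ 'd \<Rightarrow> real) \<Rightarrow> ennreal" where
  "Lp_norm p g = (if p = \<infinity> then esssup lborel (\<lambda>x. ennreal \<bar>g x\<bar>)
     else ennpow (\<integral>\<^sup>+ x. ennreal (\<bar>g x\<bar> powr enn2real p) \<partial>lborel) (1 / enn2real p))"

end

theory Submission
  imports Defs
begin

text \<open>
  The idea is to replace \<open>f\<close> by a convex function of the form \<open>A |x|\<^sup>2 + g x\<close> with \<open>g\<close> a trigonometric
  polynomial, because such functions can be replaced by polynomials without losing convexity: the
  Taylor polynomials \<open>S\<close> of the cosine of degree divisible by 4 make \<open>S - cos\<close> convex, and on bounded
  sets they converge uniformly while \<open>|S u - cos u| \<le> exp |u|\<close>, which the weight absorbs as \<open>\<alpha> > 1\<close>.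

  To find \<open>g\<close>, first replace \<open>f\<close> by a convex minorant \<open>h\<close> with Lipschitz constant \<open>L\<close> that agrees with \<open>f\<close> on
  a large ball. For a large period \<open>T\<close> and \<open>A = 2 L / T\<close>, the periodic function
  \<open>sup {h (x + z) - A |x + z|\<^sup>2 | z \<in> T \<int>\<^sup>d}\<close> agrees with \<open>h x - A |x|\<^sup>2\<close> for \<open>|x| \<le> T / 4\<close>, and adding
  \<open>A |x|\<^sup>2\<close> to it gives a supremum of convex functions. Convolving in each coordinate with the
  nonnegative trigonometric kernel \<open>(1 + cos t)\<^sup>n\<close> keeps this convexity and produces \<open>g\<close>.

  The resulting polynomials converge to \<open>f\<close> uniformly on balls and are dominated by a multiple of
  \<open>|f x| + exp (|x|\<^sup>\<alpha> / 2)\<close>, so dominated convergence gives the claim.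
\<close>

section \<open>Polynomials in several variables\<close>

lemma finite_multiindices: "finite {a :: 'd::finite \<Rightarrow> nat. sum a UNIV \<le> n}"
proof (rule finite_subset)
  show "{a :: 'd \<Rightarrow> nat. sum a UNIV \<le> n} \<subseteq> (\<Pi>\<^sub>E i\<in>UNIV. {..n})"
  proof
    fix a :: "'d \<Rightarrow> nat"
    assume "a \<in> {a. sum a UNIV \<le> n}"
    then have "a i \<le> n" for i using member_le_sum[of i UNIV a] by simp
    then show "a \<in> (\<Pi>\<^sub>E i\<in>UNIV. {..n})" by (simp add: PiE_UNIV_domain)
  qed
  show "finite (\<Pi>\<^sub>E i\<in>(UNIV::'d set). {..n})" by (intro finite_PiE) auto
qed

lemma poly_space_mono: 
  assumes "m \<le> n" shows "poly_space m \<subseteq> (poly_space n :: (real ^ 'd \<Rightarrow> real) set)"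
proof
  fix P :: "real ^ 'd \<Rightarrow> real" assume "P \<in> poly_space m"
  then obtain c where c: "\<And>x. P x = (\<Sum>a\<in>{a. sum a UNIV \<le> m}. c a * (\<Prod>i\<in>UNIV. (x $ i) ^ a i))"
    unfolding poly_space_def by auto
  let ?c = "\<lambda>a. if sum a UNIV \<le> m then c a else 0"
  have "P x = (\<Sum>a\<in>{a. sum a UNIV \<le> n}. ?c a * (\<Prod>i\<in>UNIV. (x $ i) ^ a i))" for x
    unfolding c using assms by (intro sum.mono_neutral_cong_left finite_multiindices) auto
  then show "P \<in> poly_space n" unfolding poly_space_def by auto
qed

lemma poly_space_add:
  assumes "P \<in> poly_space n" "Q \<in> poly_space n"
  shows "(\<lambda>x. P x + Q x) \<in> poly_space n"
proof -
  from assms obtain c d where 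
    "\<And>x. P x = (\<Sum>a\<in>{a. sum a UNIV \<le> n}. c a * (\<Prod>i\<in>UNIV. (x $ i) ^ a i))"
    "\<And>x. Q x = (\<Sum>a\<in>{a. sum a UNIV \<le> n}. d a * (\<Prod>i\<in>UNIV. (x $ i) ^ a i))"
    unfolding poly_space_def by auto
  then have "P x + Q x = (\<Sum>a\<in>{a. sum a UNIV \<le> n}. (c a + d a) * (\<Prod>i\<in>UNIV. (x $ i) ^ a i))" for x
    by (simp add: distrib_right sum.distrib)
  then show ?thesis unfolding poly_space_def by (auto intro!: exI[of _ "\<lambda>a. c a + d a"])
qed

lemma poly_space_sum:
  assumes "finite I" "\<And>j. j \<in> I \<Longrightarrow> P j \<in> poly_space n"
  shows "(\<lambda>x. \<Sum>j\<in>I. P j x) \<in> poly_space n"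
  using assms
proof (induction I rule: finite_induct)
  case empty
  show ?case unfolding poly_space_def by (auto intro!: exI[of _ "\<lambda>_. 0"])
next
  case (insert j I)
  then show ?case by (simp add: poly_space_add)
qed

lemma poly_space_monomial:
  assumes "sum b UNIV \<le> n"
  shows "(\<lambda>x. k * (\<Prod>i\<in>UNIV. (x $ i) ^ b i)) \<in> poly_space n"
proof -
  have "k * (\<Prod>i\<in>UNIV. (x $ i) ^ b i) =
     (\<Sum>a\<in>{a. sum a UNIV \<le> n}. (if a = b then k else 0) * (\<Prod>i\<in>UNIV. (x $ i) ^ a i))" for x
    using assms by (simp add: if_distrib[of "\<lambda>t. t * _"] finite_multiindices cong: if_cong)
  then show ?thesis unfolding poly_space_def by (auto intro!: exI[of _ "\<lambda>a. if a = b then k else 0"])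
qed

lemma poly_space_mult:
  assumes "P \<in> poly_space m" "Q \<in> poly_space n"
  shows "(\<lambda>x. P x * Q x) \<in> poly_space (m + n)"
proof -
  from assms obtain c d where cd:
    "\<And>x. P x = (\<Sum>a\<in>{a. sum a UNIV \<le> m}. c a * (\<Prod>i\<in>UNIV. (x $ i) ^ a i))"
    "\<And>x. Q x = (\<Sum>a\<in>{a. sum a UNIV \<le> n}. d a * (\<Prod>i\<in>UNIV. (x $ i) ^ a i))"
    unfolding poly_space_def by auto
  have "(\<lambda>x. P x * Q x) = (\<lambda>x. \<Sum>a\<in>{a. sum a UNIV \<le> m}. \<Sum>b\<in>{a. sum a UNIV \<le> n}.
      (c a * d b) * (\<Prod>i\<in>UNIV. (x $ i) ^ (a i + b i)))"
    unfolding cd sum_product power_add prod.distrib by (intro ext sum.cong refl) (simp add: mult_ac)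
  also have "\<dots> \<in> poly_space (m + n)"
    by (intro poly_space_sum finite_multiindices poly_space_monomial) (auto simp: sum.distrib)
  finally show ?thesis .
qed

text \<open>The approximants are built inside the inductive class of polynomial functions; this
  places each of them in some graded space. No control of the degree is required for a limit without
  rate.\<close>

lemma real_polynomial_function_poly_space:
  fixes P :: "real ^ 'd \<Rightarrow> real"
  assumes "real_polynomial_function P"
  shows "\<exists>n. P \<in> poly_space n"
  using assms
proof induction
  case (linear g)
  have "(\<lambda>x. g (axis i 1) * (\<Prod>j\<in>UNIV. (x $ j) ^ (if j = i then 1 else 0))) \<in> poly_space 1" for i
    by (rule poly_space_monomial) simp
  then have "(\<lambda>x. \<Sum>i\<in>UNIV. g (axis i 1) * (\<Prod>j\<in>UNIV. (x $ j) ^ (if j = i then 1 else 0))) \<in> poly_space 1"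
    by (intro poly_space_sum) auto
  moreover have "(\<Prod>j\<in>UNIV. (x $ j) ^ (if j = i then 1 else 0)) = x $ i" for x :: "real ^ 'd" and i
    by (simp add: if_distrib[of "\<lambda>t. _ ^ t"] cong: if_cong)
  moreover have "g x = (\<Sum>i\<in>UNIV. g (axis i 1) * x $ i)" for x
  proof -
    interpret g: bounded_linear g by fact
    have "g x = g (\<Sum>i\<in>UNIV. x $ i *\<^sub>R axis i 1)"
      by (metis (no_types) basis_expansion scalar_mult_eq_scaleR)
    then show ?thesis by (simp add: g.sum g.scaleR mult.commute)
  qed
  ultimately have "g \<in> poly_space 1" by (metis (no_types, lifting) ext)
  then show ?case ..
next
  case (const c)
  show ?case using poly_space_monomial[of "\<lambda>_. 0" 0 c] by auto
next
  case (add P Q)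
  then obtain m n where "P \<in> poly_space m" "Q \<in> poly_space n" by auto
  then have "P \<in> poly_space (max m n)" "Q \<in> poly_space (max m n)"
    using poly_space_mono[of m "max m n"] poly_space_mono[of n "max m n"] by auto
  then show ?case using poly_space_add by blast
next
  case (mult P Q)
  then show ?case using poly_space_mult by blast
qed

lemma convex_poly_space_mono: "m \<le> n \<Longrightarrow> convex_poly_space m \<subseteq> convex_poly_space n"
  using poly_space_mono[of m n] by (auto simp: convex_poly_space_def)

section \<open>Taylor polynomials of the cosine\<close>

text \<open>The index counts the terms after the constant one, so \<open>cos_taylor k\<close> has
  degree \<open>2 * k\<close> and the parity of \<open>k\<close> decides the sign of its
  error.\<close>

primrec cos_taylor :: "nat \<Rightarrow> real \<Rightarrow> real" where
  "cos_taylor 0 u = 1"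
| "cos_taylor (Suc k) u = cos_taylor k u + (-1) ^ Suc k * u ^ (2 * Suc k) / fact (2 * Suc k)"

primrec sin_taylor :: "nat \<Rightarrow> real \<Rightarrow> real" where
  "sin_taylor 0 u = u"
| "sin_taylor (Suc k) u = sin_taylor k u + (-1) ^ Suc k * u ^ (2 * Suc k + 1) / fact (2 * Suc k + 1)"

lemma DERIV_monomial_fact:
  "((\<lambda>u::real. c * u ^ Suc n / fact (Suc n)) has_real_derivative (c * u ^ n / fact n)) (at u)"
proof -
  have fact: "(fact (Suc n) :: real) = real (Suc n) * fact n" by simp
  have "((\<lambda>u::real. c * u ^ Suc n / fact (Suc n)) has_real_derivative
      (c * (real (Suc n) * u ^ n) / fact (Suc n))) (at u)"
    by (rule derivative_eq_intros refl | simp)+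
  moreover have "c * (real (Suc n) * u ^ n) / fact (Suc n) = c * u ^ n / fact n"
    unfolding fact by (simp add: divide_simps del: of_nat_Suc)
  ultimately show ?thesis by simp
qed

lemma DERIV_sin_taylor: "(sin_taylor k has_real_derivative cos_taylor k u) (at u)"
proof (induction k)
  case 0
  show ?case by (simp add: DERIV_ident)
next
  case (Suc k)
  have "((\<lambda>u. sin_taylor k u + (-1) ^ Suc k * u ^ Suc (2 * Suc k) / fact (Suc (2 * Suc k)))
      has_real_derivative cos_taylor k u + (-1) ^ Suc k * u ^ (2 * Suc k) / fact (2 * Suc k)) (at u)"
    by (rule DERIV_add[OF Suc DERIV_monomial_fact])
  moreover have "Suc (2 * Suc k) = 2 * Suc k + 1" by simp
  ultimately show ?case by (simp only: sin_taylor.simps(2)[abs_def] cos_taylor.simps)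
qed

lemma DERIV_cos_taylor: "(cos_taylor (Suc k) has_real_derivative - sin_taylor k u) (at u)"
proof (induction k)
  case 0
  have "((\<lambda>u::real. 1 + (-1) * u ^ Suc 1 / fact (Suc 1)) has_real_derivative 0 + (-1) * u ^ 1 / fact 1) (at u)"
    by (rule DERIV_add[OF DERIV_const DERIV_monomial_fact])
  then show ?case by (simp add: numeral_2_eq_2)
next
  case (Suc k)
  have "((\<lambda>u. cos_taylor (Suc k) u + (-1) ^ Suc (Suc k) * u ^ Suc (2 * Suc k + 1) / fact (Suc (2 * Suc k + 1)))
      has_real_derivative - sin_taylor k u + (-1) ^ Suc (Suc k) * u ^ (2 * Suc k + 1) / fact (2 * Suc k + 1)) (at u)"
    by (rule DERIV_add[OF Suc DERIV_monomial_fact])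
  moreover have "Suc (2 * Suc k + 1) = 2 * Suc (Suc k)" by simp
  ultimately show ?case by (simp only: cos_taylor.simps(2)[of "Suc k", abs_def] sin_taylor.simps) simp
qed

lemma taylor_0 [simp]: "cos_taylor k 0 = 1" "sin_taylor k 0 = 0"
  by (induction k) auto

text \<open>The second derivative of the error at stage \<open>Suc k\<close> is minus the error at
  stage \<open>k\<close>. Hence the sign at one stage yields convexity at the next, and convexity
  yields the sign again, so both claims are proved in one induction. Index 0 is excepted because
  \<open>1 - cos u\<close> is not convex.\<close>

lemma cos_taylor_alternating:
  "convex_on UNIV (\<lambda>u. (-1) ^ k * (cos_taylor k u - cos u)) \<or> k = 0"
  "0 \<le> (-1) ^ k * (cos_taylor k u - cos u)"
proof (induction k arbitrary: u)
  case 0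
  { case 1 show ?case by simp next
    case 2 show ?case by simp }
next
  case (Suc k)
  let ?h = "\<lambda>u. (-1) ^ Suc k * (cos_taylor (Suc k) u - cos u)"
  let ?h' = "\<lambda>u. (-1) ^ Suc k * (- sin_taylor k u - - sin u)"
  let ?h'' = "\<lambda>u. (-1) ^ Suc k * (- cos_taylor k u - - cos u)"
  have d1: "(?h has_real_derivative ?h' u) (at u)" for u
    by (intro DERIV_cmult DERIV_diff DERIV_cos_taylor DERIV_cos)
  have d2: "(?h' has_real_derivative ?h'' u) (at u)" for u
    by (intro DERIV_cmult DERIV_diff DERIV_minus DERIV_sin_taylor DERIV_sin)
  have pos: "0 \<le> ?h'' u" for u
    using Suc.IH(2)[of u] by (simp add: algebra_simps)
  have cvx: "convex_on UNIV ?h"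
    by (rule f''_ge0_imp_convex[OF convex_UNIV d1 d2 pos])
  { case 1 show ?case using cvx by simp next
    case 2
    \<comment> \<open>The error and its derivative both vanish at 0, so the tangent there is the
      zero line.\<close>
    have "?h' 0 * (u - 0) \<le> ?h u - ?h 0"
      by (rule convex_on_imp_above_tangent[OF cvx]) (use d1[of 0] in auto)
    then show ?case by simp }
qed

lemma cos_taylor_convex: "convex_on UNIV (\<lambda>u. cos_taylor (2 * Suc k) u - cos u)"
  using cos_taylor_alternating(1)[of "2 * Suc k"] by simp

text \<open>Consecutive Taylor polynomials lie on opposite sides of the cosine, so the error is at
  most the term by which they differ.\<close>

lemma cos_taylor_error:
  "\<bar>cos_taylor k u - cos u\<bar> \<le> \<bar>u\<bar> ^ (2 * Suc k) / fact (2 * Suc k)"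
proof -
  let ?s = "(-1::real) ^ k"
  have s: "?s * ?s = 1" "\<bar>?s\<bar> = 1" by (auto simp flip: power_mult_distrib)
  have e: "\<bar>u\<bar> ^ (2 * Suc k) = u ^ (2 * Suc k)" by (metis abs_ge_self dvd_triv_left power_even_abs)
  have "0 \<le> ?s * (cos_taylor k u - cos u)" "0 \<le> - ?s * (cos_taylor (Suc k) u - cos u)"
    using cos_taylor_alternating(2)[of k u] cos_taylor_alternating(2)[of "Suc k" u] by simp_all
  moreover have "- ?s * (cos_taylor (Suc k) u - cos u) =
      - (?s * (cos_taylor k u - cos u)) + ?s * ?s * (u ^ (2 * Suc k) / fact (2 * Suc k))"
    by (simp only: cos_taylor.simps power_Suc) (simp add: algebra_simps)
  ultimately have "\<bar>?s * (cos_taylor k u - cos u)\<bar> \<le> u ^ (2 * Suc k) / fact (2 * Suc k)"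
    unfolding s by linarith
  then show ?thesis unfolding abs_mult s e by simp
qed

text \<open>A single term of the exponential series. With \<open>cos_taylor_error\<close> this
  bounds the Taylor error by \<open>exp \<bar>u\<bar>\<close> for every degree at once.\<close>

lemma power_fact_le_exp: "0 \<le> (u::real) \<Longrightarrow> u ^ n / fact n \<le> exp u"
proof -
  assume u: "0 \<le> u"
  have "(\<Sum>m\<in>{n}. u ^ m /\<^sub>R fact m) \<le> (\<Sum>m. u ^ m /\<^sub>R fact m)"
    using u by (intro sum_le_suminf summable_exp_generic) auto
  then show ?thesis by (simp add: exp_def divide_inverse mult.commute)
qed

lemma power_fact_tendsto_0: "(\<lambda>n. (u::real) ^ n / fact n) \<longlonglongrightarrow> 0"
  using summable_LIMSEQ_zero[OF summable_exp_generic[of u]] by (simp add: divide_inverse mult.commute)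

section \<open>Approximation by polynomials up to a convex error\<close>

text \<open>Convexity of \<open>P - G\<close> makes the approximants \<open>P\<close> convex whenever \<open>G\<close> is; the bound must not depend
  on \<open>P\<close>.\<close>
definition poly_approximable_within :: "real \<Rightarrow> real \<Rightarrow> ('a::real_normed_vector \<Rightarrow> real) \<Rightarrow> bool" where
  "poly_approximable_within K c G \<longleftrightarrow> (\<forall>M. \<forall>\<epsilon>>0. \<exists>P. real_polynomial_function P \<and>
     convex_on UNIV (\<lambda>x. P x - G x) \<and> (\<forall>x. \<bar>P x - G x\<bar> \<le> K * exp (c * norm x)) \<and>
     (\<forall>x. norm x \<le> M \<longrightarrow> \<bar>P x - G x\<bar> \<le> \<epsilon>))"

text \<open>The rate \<open>c\<close> may be arbitrary, since every exponential is eventually below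
  \<open>exp (t powr \<alpha> / 2)\<close>. Nonnegative \<open>K\<close> and \<open>c\<close> allow
  the rates of two functions to be raised to a common one.\<close>

definition poly_approximable :: "('a::real_normed_vector \<Rightarrow> real) \<Rightarrow> bool" where
  "poly_approximable G \<longleftrightarrow> (\<exists>K c. 0 \<le> K \<and> 0 \<le> c \<and> poly_approximable_within K c G)"

lemma poly_approximable_withinE:
  assumes "poly_approximable_within K c G" "\<epsilon> > 0"
  obtains P where "real_polynomial_function P" "convex_on UNIV (\<lambda>x. P x - G x)"
    "\<And>x. \<bar>P x - G x\<bar> \<le> K * exp (c * norm x)" "\<And>x. norm x \<le> M \<Longrightarrow> \<bar>P x - G x\<bar> \<le> \<epsilon>"
proof -
  from assms have "\<exists>P. real_polynomial_function P \<and>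
     convex_on UNIV (\<lambda>x. P x - G x) \<and> (\<forall>x. \<bar>P x - G x\<bar> \<le> K * exp (c * norm x)) \<and>
     (\<forall>x. norm x \<le> M \<longrightarrow> \<bar>P x - G x\<bar> \<le> \<epsilon>)"
    unfolding poly_approximable_within_def by simp
  then show ?thesis using that by auto
qed

lemma poly_approximableI:
  assumes "0 \<le> K" "0 \<le> c"
    "\<And>M \<epsilon>. \<epsilon> > 0 \<Longrightarrow> \<exists>P. real_polynomial_function P \<and>
     convex_on UNIV (\<lambda>x. P x - G x) \<and> (\<forall>x. \<bar>P x - G x\<bar> \<le> K * exp (c * norm x)) \<and>
     (\<forall>x. norm x \<le> M \<longrightarrow> \<bar>P x - G x\<bar> \<le> \<epsilon>)"
  shows "poly_approximable G"
proof -
  have "poly_approximable_within K c G" unfolding poly_approximable_within_def using assms(3) by simp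
  then show ?thesis unfolding poly_approximable_def using assms(1,2) by auto
qed

lemma poly_approximable_add:
  assumes "poly_approximable G" "poly_approximable H"
  shows "poly_approximable (\<lambda>x. G x + H x)"
proof -
  obtain K c K' c' where K: "K \<ge> 0" "c \<ge> 0" "poly_approximable_within K c G"
    and K': "K' \<ge> 0" "c' \<ge> 0" "poly_approximable_within K' c' H"
    using assms unfolding poly_approximable_def by auto
  show ?thesis
  proof (rule poly_approximableI[of "K + K'" "max c c'"])
    fix M and \<epsilon> :: real assume "\<epsilon> > 0"
    then have "\<epsilon> / 2 > 0" by simp
    obtain P where P: "real_polynomial_function P" "convex_on UNIV (\<lambda>x. P x - G x)"
      "\<And>x. \<bar>P x - G x\<bar> \<le> K * exp (c * norm x)" "\<And>x. norm x \<le> M \<Longrightarrow> \<bar>P x - G x\<bar> \<le> \<epsilon> / 2"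
      using poly_approximable_withinE[OF K(3) \<open>\<epsilon> / 2 > 0\<close>, of M] by metis
    obtain Q where Q: "real_polynomial_function Q" "convex_on UNIV (\<lambda>x. Q x - H x)"
      "\<And>x. \<bar>Q x - H x\<bar> \<le> K' * exp (c' * norm x)" "\<And>x. norm x \<le> M \<Longrightarrow> \<bar>Q x - H x\<bar> \<le> \<epsilon> / 2"
      using poly_approximable_withinE[OF K'(3) \<open>\<epsilon> / 2 > 0\<close>, of M] by metis
    have "real_polynomial_function (\<lambda>x. P x + Q x)"
      using P(1) Q(1) by (rule real_polynomial_function.intros)
    moreover have "convex_on UNIV (\<lambda>x. P x + Q x - (G x + H x))"
      using convex_on_add[OF P(2) Q(2)] by (simp add: algebra_simps)
    moreover have "\<bar>P x + Q x - (G x + H x)\<bar> \<le> (K + K') * exp (max c c' * norm x)" for x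
    proof -
      have "K * exp (c * norm x) \<le> K * exp (max c c' * norm x)"
        "K' * exp (c' * norm x) \<le> K' * exp (max c c' * norm x)"
        using K(1) K'(1) by (auto intro!: mult_left_mono mult_right_mono)
      then show ?thesis using P(3)[of x] Q(3)[of x] unfolding distrib_right by linarith
    qed
    moreover have "\<bar>P x + Q x - (G x + H x)\<bar> \<le> \<epsilon>" if "norm x \<le> M" for x
      using P(4)[OF that] Q(4)[OF that] by linarith
    ultimately show "\<exists>P. real_polynomial_function P \<and> convex_on UNIV (\<lambda>x. P x - (G x + H x)) \<and>
       (\<forall>x. \<bar>P x - (G x + H x)\<bar> \<le> (K + K') * exp (max c c' * norm x)) \<and>
       (\<forall>x. norm x \<le> M \<longrightarrow> \<bar>P x - (G x + H x)\<bar> \<le> \<epsilon>)" by blast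
  qed (use K K' in auto)
qed

lemma poly_approximable_polynomial: "real_polynomial_function G \<Longrightarrow> poly_approximable G"
  by (rule poly_approximableI[of 0 0]) (auto intro!: exI[of _ G] simp: convex_on_const)

lemma real_polynomial_function_cos_taylor:
  assumes "real_polynomial_function g"
  shows "real_polynomial_function (\<lambda>x. cos_taylor k (g x))"
proof (induction k)
  case 0
  show ?case by (simp add: real_polynomial_function.intros)
next
  case (Suc k)
  show ?case
    unfolding cos_taylor.simps divide_inverse
    by (intro real_polynomial_function.intros(2-4) real_polynomial_function_power Suc assms)
qed

lemma convex_on_inner_affine:
  fixes l :: "'a::real_inner"
  assumes "convex_on UNIV \<phi>"
  shows "convex_on UNIV (\<lambda>x. \<phi> (l \<bullet> x + \<theta>))"
proof (rule convex_onI)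
  fix t :: real and x y assume t: "0 < t" "t < 1"
  have "l \<bullet> ((1 - t) *\<^sub>R x + t *\<^sub>R y) + \<theta> = (1 - t) *\<^sub>R (l \<bullet> x + \<theta>) + t *\<^sub>R (l \<bullet> y + \<theta>)"
    by (simp add: inner_add_right algebra_simps)
  then show "\<phi> (l \<bullet> ((1 - t) *\<^sub>R x + t *\<^sub>R y) + \<theta>) \<le> (1 - t) * \<phi> (l \<bullet> x + \<theta>) + t * \<phi> (l \<bullet> y + \<theta>)"
    using convex_onD[OF assms, of t "l \<bullet> x + \<theta>" "l \<bullet> y + \<theta>"] t by simp
qed simp

text \<open>Composing with an affine form and scaling by a nonnegative factor both preserve
  convexity of the Taylor error. The degree-free bound by the exponential gives the global estimate
  with rate \<open>norm l\<close>; decay of powers over factorials gives the local one.\<close>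

lemma poly_approximable_ridge_nonneg:
  fixes l :: "'a::euclidean_space"
  assumes a: "0 \<le> a"
  shows "poly_approximable (\<lambda>x. a * cos (l \<bullet> x + \<theta>))"
proof (rule poly_approximableI[of "a * exp \<bar>\<theta>\<bar>" "norm l"])
  fix M and \<epsilon> :: real assume "\<epsilon> > 0"
  \<comment> \<open>\<open>B\<close> bounds the phase on the ball of radius \<open>M\<close>, which
    may be negative.\<close>
  define B where "B = norm l * max M 0 + \<bar>\<theta>\<bar>"
  \<comment> \<open>The exponent in the error bound for the Taylor index
    \<open>2 * Suc k\<close>.\<close>
  define N where "N k = 2 * Suc (2 * Suc k)" for k :: nat
  have "(\<lambda>n. a * (B ^ n / fact n)) \<longlonglongrightarrow> a * 0"
    by (intro tendsto_intros power_fact_tendsto_0)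
  then have "(\<lambda>n. a * (B ^ n / fact n)) \<longlonglongrightarrow> 0" by simp
  moreover have "strict_mono N" unfolding N_def by (simp add: strict_mono_def)
  ultimately have "((\<lambda>n. a * (B ^ n / fact n)) \<circ> N) \<longlonglongrightarrow> 0" by (rule LIMSEQ_subseq_LIMSEQ)
  then have "\<forall>\<^sub>F k in sequentially. ((\<lambda>n. a * (B ^ n / fact n)) \<circ> N) k < \<epsilon>"
    using \<open>\<epsilon> > 0\<close> by (rule order_tendstoD)
  then obtain k where k: "a * (B ^ N k / fact (N k)) < \<epsilon>"
    unfolding eventually_sequentially by auto
  let ?P = "\<lambda>x. a * cos_taylor (2 * Suc k) (l \<bullet> x + \<theta>)"
  have err: "\<bar>?P x - a * cos (l \<bullet> x + \<theta>)\<bar> \<le> a * (\<bar>l \<bullet> x + \<theta>\<bar> ^ N k / fact (N k))" for x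
    using mult_left_mono[OF cos_taylor_error[of "2 * Suc k" "l \<bullet> x + \<theta>"] a] a
    unfolding N_def by (simp only: right_diff_distrib[symmetric] abs_mult abs_of_nonneg)
  have u: "\<bar>l \<bullet> x + \<theta>\<bar> \<le> norm l * norm x + \<bar>\<theta>\<bar>" for x
    using Cauchy_Schwarz_ineq2[of l x] by linarith
  have "real_polynomial_function ?P"
    by (intro real_polynomial_function.intros real_polynomial_function_cos_taylor bounded_linear_inner_right)
  moreover have "convex_on UNIV (\<lambda>x. ?P x - a * cos (l \<bullet> x + \<theta>))"
    using convex_on_cmul[OF a convex_on_inner_affine[OF cos_taylor_convex[of k]]]
    by (simp only: right_diff_distrib)
  moreover have "\<bar>?P x - a * cos (l \<bullet> x + \<theta>)\<bar> \<le> a * exp \<bar>\<theta>\<bar> * exp (norm l * norm x)" for x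
  proof -
    have "\<bar>l \<bullet> x + \<theta>\<bar> ^ N k / fact (N k) \<le> exp \<bar>l \<bullet> x + \<theta>\<bar>" by (intro power_fact_le_exp) simp
    also have "\<dots> \<le> exp (norm l * norm x + \<bar>\<theta>\<bar>)" using u by simp
    finally show ?thesis using err[of x] a
      by (smt (verit) exp_add mult.assoc mult.commute mult_left_mono)
  qed
  moreover have "\<bar>?P x - a * cos (l \<bullet> x + \<theta>)\<bar> \<le> \<epsilon>" if "norm x \<le> M" for x
  proof -
    have "\<bar>l \<bullet> x + \<theta>\<bar> \<le> B" using u[of x] that mult_left_mono[of "norm x" "max M 0" "norm l"]
      unfolding B_def by (simp add: max.coboundedI1)
    then have "\<bar>l \<bullet> x + \<theta>\<bar> ^ N k / fact (N k) \<le> B ^ N k / fact (N k)"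
      by (intro divide_right_mono power_mono) auto
    then show ?thesis using err[of x] k a mult_left_mono by fastforce
  qed
  ultimately show "\<exists>P. real_polynomial_function P \<and> convex_on UNIV (\<lambda>x. P x - a * cos (l \<bullet> x + \<theta>)) \<and>
       (\<forall>x. \<bar>P x - a * cos (l \<bullet> x + \<theta>)\<bar> \<le> a * exp \<bar>\<theta>\<bar> * exp (norm l * norm x)) \<and>
       (\<forall>x. norm x \<le> M \<longrightarrow> \<bar>P x - a * cos (l \<bullet> x + \<theta>)\<bar> \<le> \<epsilon>)" by blast
qed (use a in auto)

text \<open>Shifting the phase by \<open>pi\<close> absorbs a negative sign of
  \<open>a\<close>.\<close>

lemma poly_approximable_ridge:
  fixes l :: "'a::euclidean_space"
  shows "poly_approximable (\<lambda>x. a * cos (l \<bullet> x + \<theta>))"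
proof (cases "0 \<le> a")
  case False
  have "(\<lambda>x. a * cos (l \<bullet> x + \<theta>)) = (\<lambda>x. - a * cos (l \<bullet> x + (\<theta> + pi)))"
    by (simp flip: add.assoc)
  then show ?thesis
    using poly_approximable_ridge_nonneg[of "- a" l "\<theta> + pi"] False by simp
qed (rule poly_approximable_ridge_nonneg)

section \<open>A nonnegative trigonometric kernel\<close>

text \<open>Frequencies are integers rather than naturals, so that the frequency
  \<open>m - 1\<close> from the product formula stays in the class.\<close>

inductive cos_sum :: "(real \<Rightarrow> real) \<Rightarrow> bool" where
  cosine: "cos_sum (\<lambda>t. a * cos (of_int m * t))"
| add: "cos_sum k \<Longrightarrow> cos_sum k' \<Longrightarrow> cos_sum (\<lambda>t. k t + k' t)"

lemma cos_sum_scale: "cos_sum k \<Longrightarrow> cos_sum (\<lambda>t. b * k t)"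
proof (induction rule: cos_sum.induct)
  case (cosine a m)
  show ?case using cos_sum.cosine[of "b * a" m] by (simp add: mult.assoc)
next
  case (add k k')
  then show ?case using cos_sum.add by (simp add: distrib_left)
qed

lemma cos_sum_mult_cos: "cos_sum k \<Longrightarrow> cos_sum (\<lambda>t. cos t * k t)"
proof (induction rule: cos_sum.induct)
  case (cosine a m)
  have "cos t * (a * cos (of_int m * t)) = a/2 * cos (of_int (m + 1) * t) + a/2 * cos (of_int (m - 1) * t)" for t
  proof -
    have 1: "of_int (m + 1) * t = of_int m * t + t" "of_int (m - 1) * t = of_int m * t - t"
      by (auto simp: algebra_simps)
    show ?thesis unfolding 1 cos_add cos_diff by (simp add: algebra_simps)
  qed
  then show ?case
    using cos_sum.add[OF cos_sum.cosine[of "a/2" "m + 1"] cos_sum.cosine[of "a/2" "m - 1"]] by (simp only:)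
next
  case (add k k')
  then show ?case using cos_sum.add by (simp add: distrib_left)
qed

lemma cos_sum_kernel: "cos_sum (\<lambda>t. (1 + cos t) ^ n)"
proof (induction n)
  case 0
  show ?case using cos_sum.cosine[of 1 0] by simp
next
  case (Suc n)
  then show ?case using cos_sum.add[OF Suc cos_sum_mult_cos[OF Suc]] by (simp add: distrib_right)
qed

lemma cos_sum_continuous: "cos_sum k \<Longrightarrow> continuous_on S k"
  by (induction rule: cos_sum.induct) (auto intro!: continuous_intros)

text \<open>The difference of the two integrands is the derivative of
  \<open>sin t * (1 + cos t) ^ n\<close>, which vanishes at both ends of the interval.\<close>

lemma integral_kernel_Suc:
  "(real n + 1) * integral {-pi..pi} (\<lambda>t. (1 + cos t) ^ Suc n)
     = (2 * real n + 1) * integral {-pi..pi} (\<lambda>t. (1 + cos t) ^ n)"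
proof -
  let ?I = "\<lambda>n. integral {-pi..pi} (\<lambda>t::real. (1 + cos t) ^ n)"
  let ?F = "\<lambda>t::real. sin t * (1 + cos t) ^ n"
  let ?f = "\<lambda>t::real. (real n + 1) * (1 + cos t) ^ Suc n - (2 * real n + 1) * (1 + cos t) ^ n"
  have int: "(\<lambda>t::real. (1 + cos t) ^ n) integrable_on {-pi..pi}" for n
    by (intro integrable_continuous_interval continuous_intros)
  have "(?F has_real_derivative ?f t) (at t within {-pi..pi})" for t
  proof (cases n)
    case 0
    then show ?thesis by (auto intro!: derivative_eq_intros)
  next
    case (Suc m)
    \<comment> \<open>This factorization restores the power of \<open>1 + cos t\<close> lost by
      differentiation.\<close>
    have s: "sin t * sin t = (1 + cos t) * (1 - cos t)"
      using sin_cos_squared_add[of t] by (simp add: power2_eq_square algebra_simps)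
    have "((\<lambda>t. (1 + cos t) ^ n) has_real_derivative real n * (1 + cos t) ^ (n - Suc 0) * (- sin t)) (at t within {-pi..pi})"
      by (auto intro!: derivative_eq_intros)
    from DERIV_mult[OF _ this, of sin "cos t"]
    have "(?F has_real_derivative cos t * (1 + cos t) ^ n + real n * (1 + cos t) ^ (n - Suc 0) * (- sin t) * sin t) (at t within {-pi..pi})"
      by (auto intro!: derivative_eq_intros)
    also have "cos t * (1 + cos t) ^ n + real n * (1 + cos t) ^ (n - Suc 0) * (- sin t) * sin t
        = cos t * (1 + cos t) ^ n - real n * (sin t * sin t * (1 + cos t) ^ m)"
      using Suc by simp
    also have "\<dots> = ?f t"
      unfolding s using Suc by (simp add: algebra_simps)
    finally show ?thesis .
  qed
  then have "(?f has_integral (?F pi - ?F (-pi))) {-pi..pi}"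
    by (intro fundamental_theorem_of_calculus) (auto simp: has_real_derivative_iff_has_vector_derivative)
  then have "integral {-pi..pi} ?f = 0" by (simp add: integral_unique)
  moreover have "integral {-pi..pi} ?f = (real n + 1) * ?I (Suc n) - (2 * real n + 1) * ?I n"
    using int[of n] int[of "Suc n"]
    by (subst integral_diff) (auto intro!: integrable_on_mult_right simp del: power_Suc)
  ultimately show ?thesis by simp
qed

lemma integral_kernel_pos: "0 < integral {-pi..pi} (\<lambda>t::real. (1 + cos t) ^ n)"
proof (induction n)
  case (Suc n)
  have "0 < (real n + 1) * integral {-pi..pi} (\<lambda>t. (1 + cos t) ^ Suc n)"
    unfolding integral_kernel_Suc using Suc by (intro mult_pos_pos) auto
  then show ?case by (simp add: zero_less_mult_iff)
qed simp

text \<open>For the normalized kernel \<open>(1 + cos t) ^ n\<close> the recurrence gives the mean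
  of \<open>1 - cos t\<close> exactly, namely \<open>1 / (n + 1)\<close>, after writing
  \<open>1 - cos t = 2 - (1 + cos t)\<close>.\<close>

lemma ex_kernel:
  assumes "\<epsilon> > 0"
  obtains k where "cos_sum k" "\<And>t. 0 \<le> k t" "(k has_integral 1) {-pi..pi}"
    "integral {-pi..pi} (\<lambda>t. (1 - cos t) * k t) \<le> \<epsilon>"
proof -
  obtain n where n: "inverse (real (Suc n)) < \<epsilon>" using reals_Archimedean[OF assms] by auto
  define I where "I n = integral {-pi..pi} (\<lambda>t::real. (1 + cos t) ^ n)" for n
  have pos: "0 < I n" using integral_kernel_pos by (simp add: I_def)
  have rec: "(real n + 1) * I (Suc n) = (2 * real n + 1) * I n"
    unfolding I_def by (rule integral_kernel_Suc)
  define k where "k t = inverse (I n) * (1 + cos t) ^ n" for t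
  have int: "((\<lambda>t::real. (1 + cos t) ^ n) has_integral I n) {-pi..pi}" for n
    unfolding I_def by (intro integrable_integral integrable_continuous_interval continuous_intros)
  show ?thesis
  proof
    show "cos_sum k" unfolding k_def by (intro cos_sum_scale cos_sum_kernel)
    have "0 \<le> 1 + cos t" for t :: real using cos_ge_minus_one[of t] by linarith
    then show "0 \<le> k t" for t using pos by (simp add: k_def)
    have "(k has_integral inverse (I n) * I n) {-pi..pi}"
      unfolding k_def by (intro has_integral_mult_right int)
    then show "(k has_integral 1) {-pi..pi}" using pos by simp
    have "((\<lambda>t. inverse (I n) * (2 * (1 + cos t) ^ n - (1 + cos t) ^ Suc n)) has_integral
       inverse (I n) * (2 * I n - I (Suc n))) {-pi..pi}"
      by (intro has_integral_mult_right has_integral_diff int)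
    moreover have "inverse (I n) * (2 * (1 + cos t) ^ n - (1 + cos t) ^ Suc n) = (1 - cos t) * k t" for t
      by (simp add: k_def algebra_simps)
    ultimately have "integral {-pi..pi} (\<lambda>t. (1 - cos t) * k t) = inverse (I n) * (2 * I n - I (Suc n))"
      by (simp add: integral_unique)
    also have "\<dots> = inverse (real (Suc n))"
    proof -
      have "I (Suc n) = (2 * real n + 1) * I n / (real n + 1)" using rec by (simp add: field_simps)
      then show ?thesis using pos by (simp add: field_simps)
    qed
    finally show "integral {-pi..pi} (\<lambda>t. (1 - cos t) * k t) \<le> \<epsilon>" using n by simp
  qed
qed

lemma integral_periodic_reflect:
  fixes H :: "real \<Rightarrow> real"
  assumes cont: "continuous_on UNIV H" and per: "\<And>s. H (s + 2 * pi) = H s"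
  shows "integral {-pi..pi} (\<lambda>t. H (b - t)) = integral {-pi..pi} H"
proof -
  \<comment> \<open>The primitive lives on the whole line because the shift by \<open>b\<close>
    leaves \<open>{-pi..pi}\<close>.\<close>
  have "\<exists>G. \<forall>x. (- \<infinity> :: ereal) < ereal x \<longrightarrow> ereal x < \<infinity> \<longrightarrow> (G has_vector_derivative H x) (at x)"
    using cont by (intro einterval_antiderivative) (auto simp: continuous_on_eq_continuous_at)
  then obtain G where G: "(G has_real_derivative H x) (at x)" for x
    by (auto simp: has_real_derivative_iff_has_vector_derivative)
  have "((\<lambda>t. - G (b - t)) has_real_derivative H (b - t)) (at t)" for t
    by (auto intro!: derivative_eq_intros DERIV_chain2[OF G])
  then have 1: "((\<lambda>t. H (b - t)) has_integral (- G (b - pi) - - G (b - - pi))) {-pi..pi}"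
    by (intro fundamental_theorem_of_calculus)
      (auto simp flip: has_real_derivative_iff_has_vector_derivative intro: has_field_derivative_at_within)
  have 2: "(H has_integral (G pi - G (- pi))) {-pi..pi}"
    using G by (intro fundamental_theorem_of_calculus)
      (auto simp flip: has_real_derivative_iff_has_vector_derivative intro: has_field_derivative_at_within)
  \<comment> \<open>The integral over a full period, as a function of the midpoint \<open>u\<close>,
    has zero derivative by periodicity.\<close>
  have "((\<lambda>u. G (u + pi) - G (u - pi)) has_real_derivative H (u + pi) - H (u - pi)) (at u)" for u
    by (auto intro!: derivative_eq_intros DERIV_chain2[OF G])
  moreover have "H (u + pi) - H (u - pi) = 0" for u using per[of "u - pi"] by (simp add: algebra_simps)
  ultimately have "G (b + pi) - G (b - pi) = G (0 + pi) - G (0 - pi)"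
    by (intro DERIV_isconst_all) auto
  then show ?thesis using 1 2 by (simp add: integral_unique)
qed

section \<open>Coordinatewise convolution of periodic functions\<close>

text \<open>The period is written \<open>2 * pi * r\<close> so that \<open>r\<close> turns the
  angular kernel variable into a displacement.\<close>

definition lattice_periodic :: "real \<Rightarrow> (real ^ 'd \<Rightarrow> real) \<Rightarrow> bool" where
  "lattice_periodic r g \<longleftrightarrow> (\<forall>x k. g (x + (\<chi> i. 2 * pi * r * of_int (k i))) = g x)"

lemma lattice_periodicD:
  "lattice_periodic r g \<Longrightarrow> g (x + (\<chi> i. 2 * pi * r * of_int (k i))) = g x"
  by (simp add: lattice_periodic_def)

lemma lattice_periodic_axis:
  assumes "lattice_periodic r g"
  shows "g (x + (2 * pi * r) *\<^sub>R axis i 1) = g x"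
proof -
  have "(2 * pi * r) *\<^sub>R axis i 1 = (\<chi> j. 2 * pi * r * of_int (if j = i then 1 else 0))"
    by (simp add: vec_eq_iff axis_def)
  then show ?thesis using lattice_periodicD[OF assms] by metis
qed

text \<open>In an inner product space this is convexity of \<open>g x + A |x|\<^sup>2\<close>, written in a translation invariant
  form.\<close>
definition semiconvex :: "real \<Rightarrow> ('a::real_normed_vector \<Rightarrow> real) \<Rightarrow> bool" where
  "semiconvex A g \<longleftrightarrow> (\<forall>x y u v. 0 \<le> u \<longrightarrow> 0 \<le> v \<longrightarrow> u + v = 1 \<longrightarrow>
     g (u *\<^sub>R x + v *\<^sub>R y) \<le> u * g x + v * g y + A * u * v * (norm (x - y))\<^sup>2)"

text \<open>Trigonometric in the coordinates in \<open>S\<close>, with coefficients that depend only on the other ones.\<close>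
inductive partial_trig :: "real \<Rightarrow> 'd set \<Rightarrow> (real ^ 'd \<Rightarrow> real) \<Rightarrow> bool" for r S where
  cosine: "continuous_on UNIV c \<Longrightarrow> lattice_periodic r c \<Longrightarrow>
    (\<And>x y. (\<And>i. i \<notin> S \<Longrightarrow> x $ i = y $ i) \<Longrightarrow> c x = c y) \<Longrightarrow> (\<And>i. i \<notin> S \<Longrightarrow> l $ i = 0) \<Longrightarrow>
    partial_trig r S (\<lambda>x. c x * cos (l \<bullet> x + \<theta>))"
| add: "partial_trig r S g \<Longrightarrow> partial_trig r S h \<Longrightarrow> partial_trig r S (\<lambda>x. g x + h x)"

lemma partial_trig_continuous: "partial_trig r S g \<Longrightarrow> continuous_on T g"
proof (induction rule: partial_trig.induct)
  case (cosine c l \<theta>)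
  have "continuous_on T c" using cosine(1) by (rule continuous_on_subset) simp
  then show ?case by (intro continuous_intros)
qed (rule continuous_on_add)

text \<open>Convolution along axis \<open>i\<close>, with the kernel variable kept in
  \<open>{-pi..pi}\<close> whatever the period.\<close>

definition smoothed :: "real \<Rightarrow> 'd \<Rightarrow> (real \<Rightarrow> real) \<Rightarrow> (real ^ 'd \<Rightarrow> real) \<Rightarrow> real ^ 'd \<Rightarrow> real" where
  "smoothed r i k g x = integral {-pi..pi} (\<lambda>t. g (x - (r * t) *\<^sub>R axis i 1) * k t)"

lemma smoothed_integrable:
  fixes g :: "real ^ 'd \<Rightarrow> real" and k :: "real \<Rightarrow> real"
  assumes "continuous_on UNIV g" "continuous_on UNIV k"
  shows "(\<lambda>t. g (x - (r * t) *\<^sub>R axis i 1) * k t) integrable_on {-pi..pi}"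
  by (intro integrable_continuous_interval continuous_intros
        continuous_on_compose2[OF assms(1)] continuous_on_subset[OF assms(2)]) auto

lemma continuous_on_smoothed:
  assumes "continuous_on UNIV g" "continuous_on UNIV k"
  shows "continuous_on UNIV (smoothed r i k g)"
proof -
  have "continuous_on UNIV (\<lambda>x. integral (cbox (-pi) pi) (\<lambda>t. g (x - (r * t) *\<^sub>R axis i 1) * k t))"
    by (intro integral_continuous_on_param, unfold case_prod_unfold, intro continuous_intros
        continuous_on_compose2[OF assms(1)] continuous_on_compose2[OF assms(2)]) auto
  then show ?thesis by (simp add: smoothed_def[abs_def])
qed

lemma lattice_periodic_smoothed:
  assumes "lattice_periodic r g"
  shows "lattice_periodic r (smoothed r i k g)"
proof -
  have "g (x + z - w) = g (x - w)" if "z = (\<chi> i. 2 * pi * r * of_int (m i))" for x z w m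
    using lattice_periodicD[OF assms, of "x - w" m] that by (simp add: algebra_simps)
  then show ?thesis unfolding lattice_periodic_def smoothed_def by simp
qed

text \<open>An unnormalized Fourier coefficient in coordinate \<open>i\<close>: the displacement
  sets that coordinate to \<open>r * s\<close> and keeps the others.\<close>

definition coord_coeff :: "real \<Rightarrow> 'd \<Rightarrow> (real \<Rightarrow> real) \<Rightarrow> (real ^ 'd \<Rightarrow> real) \<Rightarrow> real ^ 'd \<Rightarrow> real" where
  "coord_coeff r i \<psi> c x = integral {-pi..pi} (\<lambda>s. c (x + (r * s - x $ i) *\<^sub>R axis i 1) * \<psi> s)"

lemma continuous_on_coord_coeff:
  assumes "continuous_on UNIV c" "continuous_on UNIV \<psi>"
  shows "continuous_on UNIV (coord_coeff r i \<psi> c)"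
proof -
  have "continuous_on UNIV (\<lambda>x. integral (cbox (-pi) pi) (\<lambda>s. c (x + (r * s - x $ i) *\<^sub>R axis i 1) * \<psi> s))"
    by (intro integral_continuous_on_param, unfold case_prod_unfold, intro continuous_intros
        continuous_on_compose2[OF assms(1)] continuous_on_compose2[OF assms(2)]) auto
  then show ?thesis by (simp add: coord_coeff_def[abs_def])
qed

lemma lattice_periodic_coord_coeff:
  assumes "lattice_periodic r c"
  shows "lattice_periodic r (coord_coeff r i \<psi> c)"
proof -
  have "c (x + z + (r * s - (x + z) $ i) *\<^sub>R axis i 1) = c (x + (r * s - x $ i) *\<^sub>R axis i 1)"
    if z: "z = (\<chi> j. 2 * pi * r * of_int (m j))" for x z s m
  proof -
    \<comment> \<open>Coordinate \<open>i\<close> is overwritten, so only the remaining components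
      of the lattice shift survive.\<close>
    have "x + z + (r * s - (x + z) $ i) *\<^sub>R axis i 1
      = (x + (r * s - x $ i) *\<^sub>R axis i 1) + (\<chi> j. 2 * pi * r * of_int ((m(i := 0)) j))"
      by (simp add: z vec_eq_iff axis_def)
    then show ?thesis using lattice_periodicD[OF assms] by metis
  qed
  then show ?thesis unfolding lattice_periodic_def coord_coeff_def by simp
qed

lemma coord_coeff_cong:
  assumes "\<And>x y. (\<And>j. j \<notin> S \<Longrightarrow> x $ j = y $ j) \<Longrightarrow> c x = c y"
    and "\<And>j. j \<notin> insert i S \<Longrightarrow> x $ j = y $ j"
  shows "coord_coeff r i \<psi> c x = coord_coeff r i \<psi> c y"
proof -
  have "c (x + (r * s - x $ i) *\<^sub>R axis i 1) = c (y + (r * s - y $ i) *\<^sub>R axis i 1)" for s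
    using assms(2) by (intro assms(1)) (auto simp: axis_def)
  then show ?thesis by (simp add: coord_coeff_def)
qed

text \<open>Reflecting the integration variable moves \<open>x $ i\<close> from \<open>c\<close>
  into the cosine, where the addition formula separates it from \<open>s\<close>.\<close>

lemma smoothed_cos:
  assumes "continuous_on UNIV c" "lattice_periodic r c" "r > 0"
  shows "smoothed r i (\<lambda>t. a * cos (of_int m * t)) c x =
     a * (cos (of_int m / r * x $ i) * coord_coeff r i (\<lambda>s. cos (of_int m * s)) c x
        + sin (of_int m / r * x $ i) * coord_coeff r i (\<lambda>s. sin (of_int m * s)) c x)"
proof -
  \<comment> \<open>With this \<open>b\<close>, \<open>y (b - t)\<close> equals
    \<open>x - (r * t) *\<^sub>R axis i 1\<close>, so \<open>H (b - t)\<close> is the integrand of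
    \<open>smoothed\<close>.\<close>
  define b where "b = x $ i / r"
  define y where "y s = x + (r * s - x $ i) *\<^sub>R axis i 1" for s
  define H where "H s = c (y s) * (a * cos (of_int m * (b - s)))" for s
  have cont: "continuous_on T (\<lambda>s. c (y s))" for T
    unfolding y_def by (intro continuous_on_compose2[OF assms(1)] continuous_intros) auto
  have "continuous_on UNIV H" unfolding H_def by (intro continuous_intros cont)
  moreover have "H (s + 2 * pi) = H s" for s
  proof -
    have "y (s + 2 * pi) = y s + (2 * pi * r) *\<^sub>R axis i 1"
      by (simp add: y_def algebra_simps)
    moreover have "cos (of_int m * (b - (s + 2 * pi))) = cos (of_int m * (b - s))"
    proof -
      have "of_int m * (b - (s + 2 * pi)) = of_int m * (b - s) - 2 * pi * of_int m" by (simp add: algebra_simps)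
      then show ?thesis by (simp add: cos_diff)
    qed
    ultimately show ?thesis using lattice_periodic_axis[OF assms(2)] by (simp add: H_def)
  qed
  ultimately have "integral {-pi..pi} (\<lambda>t. H (b - t)) = integral {-pi..pi} H"
    by (rule integral_periodic_reflect)
  moreover have "H (b - t) = c (x - (r * t) *\<^sub>R axis i 1) * (a * cos (of_int m * t))" for t
  proof -
    have "y (b - t) = x - (r * t) *\<^sub>R axis i 1"
      using \<open>r > 0\<close> by (simp add: y_def b_def algebra_simps)
    then show ?thesis by (simp add: H_def)
  qed
  ultimately have "smoothed r i (\<lambda>t. a * cos (of_int m * t)) c x = integral {-pi..pi} H"
    by (simp add: smoothed_def)
  also have "H = (\<lambda>s. a * cos (of_int m / r * x $ i) * (c (y s) * cos (of_int m * s))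
       + a * sin (of_int m / r * x $ i) * (c (y s) * sin (of_int m * s)))"
    by (simp add: H_def b_def right_diff_distrib cos_diff fun_eq_iff algebra_simps)
  also have "integral {-pi..pi} \<dots> = a * cos (of_int m / r * x $ i) * coord_coeff r i (\<lambda>s. cos (of_int m * s)) c x
       + a * sin (of_int m / r * x $ i) * coord_coeff r i (\<lambda>s. sin (of_int m * s)) c x"
    unfolding coord_coeff_def y_def[symmetric]
    by (subst integral_add) (auto intro!: integrable_continuous_interval continuous_intros cont)
  finally show ?thesis by (simp add: algebra_simps)
qed

lemma partial_trig_cos_cos:
  assumes "continuous_on UNIV c" "lattice_periodic r c"
    "\<And>x y. (\<And>i. i \<notin> S \<Longrightarrow> x $ i = y $ i) \<Longrightarrow> c x = c y"
    "\<And>i. i \<notin> S \<Longrightarrow> l $ i = 0" "\<And>i. i \<notin> S \<Longrightarrow> l' $ i = 0"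
  shows "partial_trig r S (\<lambda>x. a * (cos (l \<bullet> x + \<theta>) * cos (l' \<bullet> x + \<theta>') * c x))"
proof -
  let ?c = "\<lambda>x. a / 2 * c x"
  have c: "continuous_on UNIV ?c" "lattice_periodic r ?c"
    "\<And>x y. (\<And>i. i \<notin> S \<Longrightarrow> x $ i = y $ i) \<Longrightarrow> ?c x = ?c y"
  proof -
    show "continuous_on UNIV ?c" by (intro continuous_intros assms)
    show "lattice_periodic r ?c" using assms(2) by (simp add: lattice_periodic_def)
    fix x y :: "real ^ 'a" assume "\<And>i. i \<notin> S \<Longrightarrow> x $ i = y $ i"
    then have "c x = c y" by (rule assms(3))
    then show "?c x = ?c y" by simp
  qed
  have "partial_trig r S (\<lambda>x. ?c x * cos ((l - l') \<bullet> x + (\<theta> - \<theta>')) + ?c x * cos ((l + l') \<bullet> x + (\<theta> + \<theta>')))"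
    using assms(4,5) by (intro partial_trig.intros c) auto
  moreover have "?c x * cos ((l - l') \<bullet> x + (\<theta> - \<theta>')) + ?c x * cos ((l + l') \<bullet> x + (\<theta> + \<theta>'))
     = a * (cos (l \<bullet> x + \<theta>) * cos (l' \<bullet> x + \<theta>') * c x)" for x
  proof -
    have "(l - l') \<bullet> x + (\<theta> - \<theta>') = (l \<bullet> x + \<theta>) - (l' \<bullet> x + \<theta>')"
      "(l + l') \<bullet> x + (\<theta> + \<theta>') = (l \<bullet> x + \<theta>) + (l' \<bullet> x + \<theta>')"
      by (auto simp: inner_diff_left inner_add_left)
    moreover have "?c x * cos (p - q) + ?c x * cos (p + q) = a * (cos p * cos q * c x)" for p q
      by (simp add: cos_diff cos_add algebra_simps)
    ultimately show ?thesis by (simp only:)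
  qed
  ultimately show ?thesis by simp
qed

lemma partial_trig_smoothed_term:
  assumes c: "continuous_on UNIV c" "lattice_periodic r c"
    "\<And>x y. (\<And>i. i \<notin> S \<Longrightarrow> x $ i = y $ i) \<Longrightarrow> c x = c y"
    and l: "\<And>i. i \<notin> S \<Longrightarrow> l $ i = 0" and "r > 0" and "cos_sum k"
  shows "partial_trig r (insert i S) (\<lambda>x. cos (l \<bullet> x + \<theta>) * smoothed r i k c x)"
  using \<open>cos_sum k\<close>
proof induction
  case (cosine a m)
  let ?l = "(of_int m / r) *\<^sub>R axis i 1 :: real ^ 'a"
  let ?C = "coord_coeff r i (\<lambda>s. cos (of_int m * s)) c"
  let ?S = "coord_coeff r i (\<lambda>s. sin (of_int m * s)) c"
  \<comment> \<open>The phase \<open>- (pi / 2)\<close> turns the second cosine into the sine of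
    \<open>smoothed_cos\<close>; \<open>coord_coeff_cong\<close> makes the new coefficients
    independent of coordinate \<open>i\<close> too.\<close>
  have "partial_trig r (insert i S) (\<lambda>x. a * (cos (l \<bullet> x + \<theta>) * cos (?l \<bullet> x + 0) * ?C x)
     + a * (cos (l \<bullet> x + \<theta>) * cos (?l \<bullet> x + (- (pi / 2))) * ?S x))"
    using l by (intro partial_trig.add partial_trig_cos_cos continuous_on_coord_coeff
        lattice_periodic_coord_coeff coord_coeff_cong[OF c(3)] c continuous_intros)
      (auto simp: axis_def)
  moreover have "cos (?l \<bullet> x + (- (pi / 2))) = sin (of_int m / r * x $ i)"
    "cos (?l \<bullet> x + 0) = cos (of_int m / r * x $ i)" for x
    by (auto simp: inner_axis' cos_diff)
  ultimately show ?case
    unfolding smoothed_cos[OF c(1,2) \<open>r > 0\<close>] by (simp only: distrib_left mult_ac)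
next
  case (add k k')
  have "smoothed r i (\<lambda>t. k t + k' t) c x = smoothed r i k c x + smoothed r i k' c x" for x
    using add.hyps unfolding smoothed_def distrib_left
    by (intro integral_add smoothed_integrable c cos_sum_continuous)
  then show ?case using partial_trig.add[OF add.IH] by (simp add: distrib_left)
qed

text \<open>Because \<open>i \<notin> S\<close>, the frequency vectors have no component along axis
  \<open>i\<close>; the cosine is constant there and leaves the integral, so only the coefficient is
  convolved.\<close>

lemma partial_trig_smoothed:
  assumes "partial_trig r S g" "i \<notin> S" "r > 0" "cos_sum k"
  shows "partial_trig r (insert i S) (smoothed r i k g)"
  using assms(1)
proof induction
  case (cosine c l \<theta>)
  have "l \<bullet> (x - (r * t) *\<^sub>R axis i 1) = l \<bullet> x" for x t
    using cosine(4)[OF \<open>i \<notin> S\<close>] by (simp add: inner_diff_right inner_axis)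
  then have "smoothed r i k (\<lambda>x. c x * cos (l \<bullet> x + \<theta>)) = (\<lambda>x. cos (l \<bullet> x + \<theta>) * smoothed r i k c x)"
    unfolding smoothed_def integral_mult_right[symmetric] by (simp add: mult_ac)
  then show ?case
    using partial_trig_smoothed_term[OF cosine(1-4) \<open>r > 0\<close> \<open>cos_sum k\<close>] by simp
next
  case (add g h)
  have "smoothed r i k (\<lambda>x. g x + h x) = (\<lambda>x. smoothed r i k g x + smoothed r i k h x)"
    unfolding smoothed_def distrib_right
    by (intro ext integral_add smoothed_integrable partial_trig_continuous[OF add.hyps(1)]
        partial_trig_continuous[OF add.hyps(2)] cos_sum_continuous assms)
  then show ?case using partial_trig.add[OF add.IH] by simp
qed

text \<open>The convolution averages translates with nonnegative weights of total mass 1, and the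
  defect term depends only on \<open>x - y\<close>, which translation does not change.\<close>

lemma semiconvex_smoothed:
  fixes g :: "real ^ 'd \<Rightarrow> real"
  assumes g: "semiconvex A g" "continuous_on UNIV g"
    and k: "continuous_on UNIV k" "\<And>t. 0 \<le> k t" "(k has_integral 1) {-pi..pi}"
  shows "semiconvex A (smoothed r i k g)"
  unfolding semiconvex_def
proof (intro allI impI)
  fix x y :: "real ^ 'd" and u v :: real assume uv: "0 \<le> u" "0 \<le> v" "u + v = 1"
  let ?z = "\<lambda>x t. x - (r * t) *\<^sub>R axis i (1::real)"
  let ?D = "A * u * v * (norm (x - y))\<^sup>2"
  have I: "((\<lambda>t. g (?z x t) * k t) has_integral smoothed r i k g x) {-pi..pi}" for x
    unfolding smoothed_def using smoothed_integrable[OF g(2) k(1)] by (rule integrable_integral)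
  have "((\<lambda>t. u * (g (?z x t) * k t) + v * (g (?z y t) * k t) + ?D * k t) has_integral
      u * smoothed r i k g x + v * smoothed r i k g y + ?D * 1) {-pi..pi}"
    by (intro has_integral_add has_integral_mult_right I k)
  moreover have "g (?z (u *\<^sub>R x + v *\<^sub>R y) t) * k t \<le> u * (g (?z x t) * k t) + v * (g (?z y t) * k t) + ?D * k t" for t
  proof -
    have "u *\<^sub>R ?z x t + v *\<^sub>R ?z y t = u *\<^sub>R x + v *\<^sub>R y - (u + v) *\<^sub>R (r * t) *\<^sub>R axis i 1"
      by (simp add: algebra_simps)
    then have "?z (u *\<^sub>R x + v *\<^sub>R y) t = u *\<^sub>R ?z x t + v *\<^sub>R ?z y t"
      using uv(3) by simp
    moreover have "x - y = ?z x t - ?z y t" by simp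
    ultimately have "g (?z (u *\<^sub>R x + v *\<^sub>R y) t) \<le> u * g (?z x t) + v * g (?z y t) + ?D"
      using g(1) uv unfolding semiconvex_def
      by metis
    from mult_right_mono[OF this k(2)[of t]] show ?thesis by (simp add: algebra_simps)
  qed
  ultimately show "smoothed r i k g (u *\<^sub>R x + v *\<^sub>R y) \<le> u * smoothed r i k g x + v * smoothed r i k g y + ?D"
    using has_integral_le[OF I] by simp
qed

section \<open>Uniform convergence of the convolutions\<close>

lemma lattice_periodic_reduce:
  fixes x :: "real ^ 'd"
  assumes "lattice_periodic r g" "r > 0"
  obtains y :: "real ^ 'd" where "y \<in> cbox 0 (\<chi> i. 2 * pi * r)" "\<And>w. g (x + w) = g (y + w)"
proof
  define k where "k i = - \<lfloor>x $ i / (2 * pi * r)\<rfloor>" for i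
  define y where "y = x + (\<chi> i. 2 * pi * r * of_int (k i))"
  have T: "2 * pi * r > 0" using assms by simp
  have y: "y $ i = 2 * pi * r * frac (x $ i / (2 * pi * r))" for i
    using \<open>r > 0\<close> by (simp add: y_def k_def frac_def right_diff_distrib)
  show "y \<in> cbox 0 (\<chi> i. 2 * pi * r)"
    unfolding mem_box_cart y
  proof
    fix i
    have "2 * pi * r * frac (x $ i / (2 * pi * r)) \<le> 2 * pi * r * 1"
      using T frac_lt_1 by (intro mult_left_mono) (auto intro: less_imp_le)
    then show "0 $ i \<le> 2 * pi * r * frac (x $ i / (2 * pi * r)) \<and>
        2 * pi * r * frac (x $ i / (2 * pi * r)) \<le> (\<chi> i. 2 * pi * r) $ i"
      using T frac_ge_0 by simp
  qed
  show "g (x + w) = g (y + w)" for w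
    using lattice_periodicD[OF assms(1), of "x + w" k] by (simp add: y_def algebra_simps)
qed

text \<open>With a bound of this shape, convergence of the convolutions needs only the kernel's mean of
  \<open>1 - cos t\<close>.\<close>
lemma lattice_periodic_modulus:
  fixes g :: "real ^ 'd \<Rightarrow> real"
  assumes cont: "continuous_on UNIV g" and per: "lattice_periodic r g" "r > 0" and "\<epsilon> > 0"
  obtains M where "M \<ge> 0"
    "\<And>x t. \<bar>t\<bar> \<le> pi \<Longrightarrow> \<bar>g (x - (r * t) *\<^sub>R axis i 1) - g x\<bar> \<le> \<epsilon> + M * (1 - cos t)"
proof -
  obtain \<rho> where \<rho>: "\<And>y :: real ^ 'd. y \<in> cbox 0 (\<chi> i. 2 * pi * r) \<Longrightarrow> norm y \<le> \<rho>"
    using bounded_cbox unfolding bounded_iff by metis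
  \<comment> \<open>The ball contains the period cube and all its displacements by
    \<open>r * t\<close> with \<open>\<bar>t\<bar> \<le> pi\<close>.\<close>
  define K where "K = cball (0 :: real ^ 'd) (\<rho> + r * pi)"
  have "compact K" by (simp add: K_def)
  have contK: "continuous_on K g" using cont by (rule continuous_on_subset) simp
  have "uniformly_continuous_on K g" by (rule compact_uniformly_continuous[OF contK \<open>compact K\<close>])
  then obtain \<eta> where \<eta>: "\<eta> > 0" "\<And>x y. x \<in> K \<Longrightarrow> y \<in> K \<Longrightarrow> dist y x < \<eta> \<Longrightarrow> dist (g y) (g x) < \<epsilon>"
    unfolding uniformly_continuous_on_def using \<open>\<epsilon> > 0\<close> by metis
  have "bounded (g ` K)" by (intro compact_imp_bounded compact_continuous_image contK \<open>compact K\<close>)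
  then obtain B where B: "B > 0" "\<And>y. y \<in> K \<Longrightarrow> \<bar>g y\<bar> \<le> B" unfolding bounded_pos by auto
  \<comment> \<open>For \<open>\<bar>t\<bar> < \<tau>\<close> the displacement is below
    \<open>\<eta>\<close> and uniform continuity applies; \<open>\<tau>\<close> lies in the range
    where the cosine decreases.\<close>
  define \<tau> where "\<tau> = min (\<eta> / r) pi / 2"
  have \<tau>: "0 < \<tau>" "\<tau> < pi" "r * \<tau> < \<eta>"
    using \<eta>(1) \<open>r > 0\<close> pi_gt_zero by (auto simp: \<tau>_def min_def field_simps)
  have "cos \<tau> < 1" using cos_monotone_0_pi[of 0 \<tau>] \<tau> by simp
  \<comment> \<open>For \<open>\<bar>t\<bar> \<ge> \<tau>\<close> this makes
    \<open>M * (1 - cos t)\<close> at least \<open>2 * B\<close>, the trivial bound for the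
    difference.\<close>
  define M where "M = 2 * B / (1 - cos \<tau>)"
  have "M \<ge> 0" using B(1) \<open>cos \<tau> < 1\<close> by (simp add: M_def)
  moreover have "\<bar>g (x - (r * t) *\<^sub>R axis i 1) - g x\<bar> \<le> \<epsilon> + M * (1 - cos t)" if t: "\<bar>t\<bar> \<le> pi" for x t
  proof -
    obtain y where y: "y \<in> cbox 0 (\<chi> i. 2 * pi * r)" "\<And>w. g (x + w) = g (y + w)"
      using lattice_periodic_reduce[OF per] by metis
    let ?y = "y - (r * t) *\<^sub>R axis i 1"
    have eq: "g (x - (r * t) *\<^sub>R axis i 1) - g x = g ?y - g y"
      using y(2)[of 0] y(2)[of "- ((r * t) *\<^sub>R axis i 1)"] by simp
    have n: "norm ((r * t) *\<^sub>R axis i (1::real)) = r * \<bar>t\<bar>" using \<open>r > 0\<close> by (simp add: abs_mult)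
    have "norm y \<le> \<rho>" using y(1) by (rule \<rho>)
    moreover have "r * \<bar>t\<bar> \<le> r * pi" "0 \<le> r * \<bar>t\<bar>"
      using t \<open>r > 0\<close> by (auto intro!: mult_left_mono)
    ultimately have "norm y \<le> \<rho> + r * pi" "norm ?y \<le> \<rho> + r * pi"
      using norm_triangle_ineq4[of y "(r * t) *\<^sub>R axis i 1"] unfolding n by linarith+
    then have inK: "y \<in> K" "?y \<in> K" by (auto simp: K_def)
    show ?thesis
    proof (cases "\<bar>t\<bar> < \<tau>")
      case True
      have "r * \<bar>t\<bar> \<le> r * \<tau>" using True \<open>r > 0\<close> by simp
      then have "dist ?y y < \<eta>" using n \<tau>(3) by (simp add: dist_norm)
      then have "\<bar>g ?y - g y\<bar> < \<epsilon>" using \<eta>(2)[OF inK] by (simp add: dist_real_def)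
      moreover have "0 \<le> M * (1 - cos t)" using \<open>M \<ge> 0\<close> by simp
      ultimately show ?thesis unfolding eq by linarith
    next
      case False
      have "cos t \<le> cos \<tau>"
        using cos_monotone_0_pi_le[of \<tau> "\<bar>t\<bar>"] False \<tau> t by (simp add: abs_if split: if_splits)
      have "2 * B = M * (1 - cos \<tau>)" using \<open>cos \<tau> < 1\<close> by (simp add: M_def)
      also have "\<dots> \<le> M * (1 - cos t)" using \<open>cos t \<le> cos \<tau>\<close> \<open>M \<ge> 0\<close> by (intro mult_left_mono) auto
      finally show ?thesis unfolding eq using B(2)[OF inK(1)] B(2)[OF inK(2)] \<open>\<epsilon> > 0\<close> by linarith
    qed
  qed
  ultimately show ?thesis using that by blast
qed

lemma ex_smoothed_close:
  fixes g :: "real ^ 'd \<Rightarrow> real"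
  assumes g: "continuous_on UNIV g" "lattice_periodic r g" "r > 0" and "\<epsilon> > 0"
  obtains k where "cos_sum k" "\<And>t. 0 \<le> k t" "(k has_integral 1) {-pi..pi}"
    "\<And>x. \<bar>smoothed r i k g x - g x\<bar> \<le> \<epsilon>"
proof -
  obtain M where M: "M \<ge> 0"
    "\<And>x t. \<bar>t\<bar> \<le> pi \<Longrightarrow> \<bar>g (x - (r * t) *\<^sub>R axis i 1) - g x\<bar> \<le> \<epsilon> / 2 + M * (1 - cos t)"
    using lattice_periodic_modulus[OF g, of "\<epsilon> / 2"] \<open>\<epsilon> > 0\<close> by auto
  \<comment> \<open>Integrating the modulus bound against the kernel leaves
    \<open>\<epsilon> / 2 + M * \<delta>\<close>; the denominator \<open>M + 1\<close> stays
    positive when \<open>M = 0\<close>.\<close>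
  define \<delta> where "\<delta> = \<epsilon> / 2 / (M + 1)"
  have "\<delta> > 0" using \<open>\<epsilon> > 0\<close> M(1) by (simp add: \<delta>_def)
  obtain k where k: "cos_sum k" "\<And>t. 0 \<le> k t" "(k has_integral 1) {-pi..pi}"
    "integral {-pi..pi} (\<lambda>t. (1 - cos t) * k t) \<le> \<delta>"
    using ex_kernel[OF \<open>\<delta> > 0\<close>] by metis
  have contk: "continuous_on T k" for T by (rule cos_sum_continuous[OF k(1)])
  have "\<bar>smoothed r i k g x - g x\<bar> \<le> \<epsilon>" for x
  proof -
    let ?d = "\<lambda>t. g (x - (r * t) *\<^sub>R axis i 1)"
    have "((\<lambda>t. ?d t * k t - g x * k t) has_integral (smoothed r i k g x - g x * 1)) {-pi..pi}"
      unfolding smoothed_def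
      by (intro has_integral_diff has_integral_mult_right k integrable_integral smoothed_integrable g contk)
    moreover have "((\<lambda>t. \<epsilon> / 2 * k t + M * ((1 - cos t) * k t)) has_integral
       (\<epsilon> / 2 * 1 + M * integral {-pi..pi} (\<lambda>t. (1 - cos t) * k t))) {-pi..pi}"
      by (intro has_integral_add has_integral_mult_right k integrable_integral
          integrable_continuous_interval continuous_intros contk)
    moreover have "norm (?d t * k t - g x * k t) \<le> \<epsilon> / 2 * k t + M * ((1 - cos t) * k t)"
      if "t \<in> {-pi..pi}" for t
    proof -
      have "\<bar>?d t - g x\<bar> * k t \<le> (\<epsilon> / 2 + M * (1 - cos t)) * k t"
        using that by (intro mult_right_mono M(2) k(2)) auto
      moreover have "norm (?d t * k t - g x * k t) = \<bar>?d t - g x\<bar> * k t"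
        using k(2)[of t] by (simp add: abs_mult flip: left_diff_distrib)
      ultimately show ?thesis by (simp add: algebra_simps)
    qed
    ultimately have "norm (smoothed r i k g x - g x * 1) \<le> \<epsilon> / 2 * 1 + M * integral {-pi..pi} (\<lambda>t. (1 - cos t) * k t)"
      using integral_norm_bound_integral by (metis (no_types, lifting) has_integral_iff)
    also have "M * integral {-pi..pi} (\<lambda>t. (1 - cos t) * k t) \<le> M * \<delta>"
      by (intro mult_left_mono k M)
    also have "M * \<delta> \<le> \<epsilon> / 2" using M(1) \<open>\<epsilon> > 0\<close> by (simp add: \<delta>_def field_simps)
    finally show ?thesis by simp
  qed
  then show ?thesis using that k by blast
qed

text \<open>The coordinates are smoothed one after another. Each step makes one more coordinate
  trigonometric at half of the permitted error and preserves periodicity and semiconvexity.\<close>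

lemma semiconvex_partial_trig_approx:
  fixes g :: "real ^ 'd \<Rightarrow> real"
  assumes g: "continuous_on UNIV g" "lattice_periodic r g" "semiconvex A g" "r > 0"
    and "finite S" "\<epsilon> > 0"
  shows "\<exists>h. continuous_on UNIV h \<and> lattice_periodic r h \<and> semiconvex A h \<and> partial_trig r S h \<and>
     (\<forall>x. \<bar>h x - g x\<bar> \<le> \<epsilon>)"
  using \<open>finite S\<close> \<open>\<epsilon> > 0\<close>
proof (induction S arbitrary: \<epsilon> rule: finite_induct)
  case empty
  \<comment> \<open>With no coordinate treated yet, \<open>g\<close> itself is a coefficient of the
    zero frequency.\<close>
  have "partial_trig r {} (\<lambda>x. g x * cos (0 \<bullet> x + 0))"
  proof (rule partial_trig.cosine)
    fix x y :: "real ^ 'd" assume "\<And>i. i \<notin> {} \<Longrightarrow> x $ i = y $ i"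
    then have "x = y" by (simp add: vec_eq_iff)
    then show "g x = g y" by simp
  qed (use g in auto)
  then show ?case using g empty by (auto intro!: exI[of _ g])
next
  case (insert i S)
  then obtain h where h: "continuous_on UNIV h" "lattice_periodic r h" "semiconvex A h" "partial_trig r S h"
    "\<And>x. \<bar>h x - g x\<bar> \<le> \<epsilon> / 2" by (metis half_gt_zero)
  obtain k where k: "cos_sum k" "\<And>t. 0 \<le> k t" "(k has_integral 1) {-pi..pi}"
    "\<And>x. \<bar>smoothed r i k h x - h x\<bar> \<le> \<epsilon> / 2"
    using ex_smoothed_close[OF h(1,2) \<open>r > 0\<close>, of "\<epsilon> / 2" i] insert.prems by auto
  have contk: "continuous_on UNIV k" by (rule cos_sum_continuous[OF k(1)])
  have "\<bar>smoothed r i k h x - g x\<bar> \<le> \<epsilon>" for x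
    using h(5)[of x] k(4)[of x] by linarith
  then show ?case
    using continuous_on_smoothed[OF h(1) contk] lattice_periodic_smoothed[OF h(2)]
      semiconvex_smoothed[OF h(3,1) contk k(2,3)]
      partial_trig_smoothed[OF h(4) \<open>i \<notin> S\<close> \<open>r > 0\<close> k(1)] by blast
qed

section \<open>Lipschitz minorants and periodization\<close>

text \<open>Prolonging the segment from \<open>y\<close> to \<open>x\<close> by one unit beyond
  \<open>x\<close> stays in the larger ball, where the values are bounded; convexity along it then
  limits the descent from \<open>x\<close> towards \<open>y\<close>.\<close>

lemma convex_lower_cone:
  fixes f :: "'a::real_normed_vector \<Rightarrow> real"
  assumes f: "convex_on UNIV f" and B: "\<And>z. norm z \<le> R + 1 \<Longrightarrow> \<bar>f z\<bar> \<le> B" and x: "norm x \<le> R"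
  shows "f x - 2 * B * norm (y - x) \<le> f y"
proof (cases "y = x")
  case False
  define s where "s = norm (y - x)"
  define w where "w = x - (1 / s) *\<^sub>R (y - x)"
  have s: "s > 0" using False by (simp add: s_def)
  have "norm w \<le> norm x + norm ((1 / s) *\<^sub>R (y - x))" unfolding w_def by (rule norm_triangle_ineq4)
  also have "norm ((1 / s) *\<^sub>R (y - x)) = 1" using s by (simp add: s_def)
  finally have "\<bar>f w\<bar> \<le> B" using x by (intro B) simp
  have "\<bar>f x\<bar> \<le> B" using x by (intro B) simp
  have "(s / (1 + s)) *\<^sub>R w + (1 / (1 + s)) *\<^sub>R y = x"
  proof -
    have "(s / (1 + s)) *\<^sub>R w = (s / (1 + s)) *\<^sub>R x - (1 / (1 + s)) *\<^sub>R (y - x)"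
      using s by (simp add: w_def scaleR_diff_right)
    moreover have "(s / (1 + s)) *\<^sub>R x + (1 / (1 + s)) *\<^sub>R x = (s / (1 + s) + 1 / (1 + s)) *\<^sub>R x"
      by (rule scaleR_add_left[symmetric])
    moreover have "s / (1 + s) + 1 / (1 + s) = 1" using s by (simp add: field_simps)
    ultimately show ?thesis by (simp add: scaleR_diff_right)
  qed
  moreover have "f ((s / (1 + s)) *\<^sub>R w + (1 / (1 + s)) *\<^sub>R y) \<le> s / (1 + s) * f w + 1 / (1 + s) * f y"
  proof -
    have "0 \<le> s / (1 + s)" "0 \<le> 1 / (1 + s)" "s / (1 + s) + 1 / (1 + s) = 1"
      using s by (auto simp: field_simps)
    then show ?thesis using f unfolding convex_on_def by blast
  qed
  ultimately have "f x \<le> (s * f w + f y) / (1 + s)" by (simp add: add_divide_distrib)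
  then have "f x * (1 + s) \<le> s * f w + f y" using s by (simp add: field_simps)
  then have "f x - s * (f w - f x) \<le> f y" by (simp add: algebra_simps)
  moreover have "s * (f w - f x) \<le> s * (2 * B)"
    using s \<open>\<bar>f w\<bar> \<le> B\<close> \<open>\<bar>f x\<bar> \<le> B\<close> by (intro mult_left_mono) auto
  ultimately show ?thesis by (simp add: s_def mult.commute)
qed simp

text \<open>The infimal convolution of \<open>f\<close> with the cone \<open>L * norm\<close>. The
  lower bound keeps the slope \<open>L0\<close> when \<open>L\<close> grows, which later gives
  constants that do not depend on the chosen ball.\<close>

lemma lipschitz_minorant:
  fixes f :: "'a::real_normed_vector \<Rightarrow> real"
  assumes f: "convex_on UNIV f" and low: "\<And>y. f 0 - L0 * norm y \<le> f y" and L: "0 \<le> L0" "L0 \<le> L"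
  defines "h \<equiv> \<lambda>x. INF y. f y + L * norm (x - y)"
  shows "convex_on UNIV h" and "h x \<le> h y + L * norm (x - y)"
    and "f 0 - L0 * norm x \<le> h x" and "h x \<le> f x"
    and "(\<And>y. f x - L * norm (y - x) \<le> f y) \<Longrightarrow> h x = f x"
proof -
  have lb: "f 0 - L0 * norm x \<le> f y + L * norm (x - y)" for x y
  proof -
    have "L0 * norm y \<le> L0 * (norm x + norm (x - y))"
      using L norm_triangle_sub[of y x] norm_minus_commute[of y x] by (intro mult_left_mono) auto
    moreover have "L0 * norm (x - y) \<le> L * norm (x - y)" using L by (intro mult_right_mono) auto
    ultimately show ?thesis using low[of y] by (simp add: distrib_left)
  qed
  have bdd: "bdd_below (range (\<lambda>y. f y + L * norm (x - y)))" for x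
    using lb[of x] by (auto simp: bdd_below_def)
  have le: "h x \<le> f y + L * norm (x - y)" for x y
    unfolding h_def by (rule cINF_lower[OF bdd]) simp
  have greatest: "m \<le> h x" if "\<And>y. m \<le> f y + L * norm (x - y)" for m x
    unfolding h_def using that by (intro cINF_greatest) auto
  show "f 0 - L0 * norm x \<le> h x" by (rule greatest) (rule lb)
  show "h x \<le> f x" using le[of x x] by simp
  have "h x - L * norm (x - y) \<le> h y"
  proof (rule greatest)
    fix z
    have "L * norm (x - z) \<le> L * (norm (x - y) + norm (y - z))"
      using L norm_triangle_ineq[of "x - y" "y - z"] by (intro mult_left_mono) auto
    then show "h x - L * norm (x - y) \<le> f z + L * norm (y - z)"
      using le[of x z] by (simp add: distrib_left)
  qed
  then show "h x \<le> h y + L * norm (x - y)" by simp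
  show "h x = f x" if "\<And>y. f x - L * norm (y - x) \<le> f y"
  proof (rule antisym)
    show "f x \<le> h x"
    proof (rule greatest)
      fix y show "f x \<le> f y + L * norm (x - y)" using that[of y] by (simp add: norm_minus_commute)
    qed
  qed (rule \<open>h x \<le> f x\<close>)
  show "convex_on UNIV h"
  proof (rule convex_onI)
    fix t :: real and x1 x2 assume t: "0 < t" "t < 1"
    have key: "h ((1 - t) *\<^sub>R x1 + t *\<^sub>R x2) \<le> (1 - t) * (f y1 + L * norm (x1 - y1)) + t * (f y2 + L * norm (x2 - y2))" for y1 y2
    proof -
      let ?y = "(1 - t) *\<^sub>R y1 + t *\<^sub>R y2"
      have "norm ((1 - t) *\<^sub>R x1 + t *\<^sub>R x2 - ?y) = norm ((1 - t) *\<^sub>R (x1 - y1) + t *\<^sub>R (x2 - y2))"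
        by (simp add: algebra_simps)
      also have "\<dots> \<le> (1 - t) * norm (x1 - y1) + t * norm (x2 - y2)"
        using t norm_triangle_ineq[of "(1 - t) *\<^sub>R (x1 - y1)" "t *\<^sub>R (x2 - y2)"] by simp
      finally have "L * norm ((1 - t) *\<^sub>R x1 + t *\<^sub>R x2 - ?y) \<le> L * ((1 - t) * norm (x1 - y1) + t * norm (x2 - y2))"
        using L by (intro mult_left_mono) auto
      moreover have "f ?y \<le> (1 - t) * f y1 + t * f y2" using convex_onD[OF f, of t y1 y2] t by simp
      ultimately show ?thesis using le[of "(1 - t) *\<^sub>R x1 + t *\<^sub>R x2" ?y] by (simp add: algebra_simps)
    qed
    let ?H = "h ((1 - t) *\<^sub>R x1 + t *\<^sub>R x2)"
    \<comment> \<open>The two infima are taken in turn: first over \<open>y1\<close> with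
      \<open>y2\<close> fixed, then over \<open>y2\<close>.\<close>
    have "(?H - t * (f y2 + L * norm (x2 - y2))) / (1 - t) \<le> h x1" for y2
      using t key[of _ y2] by (intro greatest) (simp add: pos_divide_le_eq algebra_simps)
    then have "(?H - (1 - t) * h x1) / t \<le> h x2"
      using t by (intro greatest) (simp add: pos_divide_le_eq algebra_simps)
    then show "?H \<le> (1 - t) * h x1 + t * h x2" using t by (simp add: pos_divide_le_eq algebra_simps)
  qed simp
qed

section \<open>Semiconvexity and lattice periodization\<close>

lemma norm_square_convex_combination:
  fixes x y :: "'a::real_inner"
  assumes "u + v = 1"
  shows "(norm (u *\<^sub>R x + v *\<^sub>R y))\<^sup>2 = u * (norm x)\<^sup>2 + v * (norm y)\<^sup>2 - u * v * (norm (x - y))\<^sup>2"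
proof -
  have v: "v = 1 - u" using assms by simp
  show ?thesis unfolding v power2_norm_eq_inner
    by (simp add: inner_add_left inner_add_right inner_diff_left inner_diff_right inner_commute algebra_simps)
qed

lemma semiconvex_iff_convex:
  fixes g :: "'a::real_inner \<Rightarrow> real"
  shows "semiconvex A g \<longleftrightarrow> convex_on UNIV (\<lambda>x. g x + A * (norm x)\<^sup>2)"
proof -
  have "g (u *\<^sub>R x + v *\<^sub>R y) \<le> u * g x + v * g y + A * u * v * (norm (x - y))\<^sup>2 \<longleftrightarrow>
     g (u *\<^sub>R x + v *\<^sub>R y) + A * (norm (u *\<^sub>R x + v *\<^sub>R y))\<^sup>2
       \<le> u * (g x + A * (norm x)\<^sup>2) + v * (g y + A * (norm y)\<^sup>2)" if "u + v = 1" for u v x y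
    unfolding norm_square_convex_combination[OF that] by (simp add: algebra_simps)
  then show ?thesis unfolding semiconvex_def convex_on_def by auto
qed

lemma lattice_norm_ge:
  fixes k :: "'d::finite \<Rightarrow> int"
  assumes "T > 0" "k \<noteq> (\<lambda>_. 0)"
  shows "T \<le> norm ((\<chi> i. T * of_int (k i)) :: real ^ 'd)"
proof -
  obtain i where "k i \<noteq> 0" using assms(2) by auto
  then have "1 \<le> \<bar>real_of_int (k i)\<bar>" by linarith
  then have "T \<le> \<bar>T * of_int (k i)\<bar>" using assms(1) by (simp add: abs_mult)
  also have "\<dots> \<le> norm ((\<chi> i. T * of_int (k i)) :: real ^ 'd)"
    using component_le_norm_cart[of "(\<chi> i. T * of_int (k i)) :: real ^ 'd" i] by simp
  finally show ?thesis .
qed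

text \<open>\<open>A\<close> is tuned to the Lipschitz constant: for
  \<open>norm x \<le> T / 4\<close>, moving by a nonzero lattice vector costs at least as much in
  the quadratic term as \<open>h\<close> can gain, so the unshifted term attains the
  supremum.\<close>

lemma convex_periodization:
  fixes h :: "real ^ 'd \<Rightarrow> real"
  assumes h: "convex_on UNIV h" and lip: "\<And>x y. h x \<le> h y + L * norm (x - y)" and "L > 0" "T > 0"
  defines "A \<equiv> 2 * L / T"
  obtains g where "lattice_periodic (T / (2 * pi)) g" "semiconvex A g" "continuous_on UNIV g"
    "\<And>x. norm x \<le> T / 4 \<Longrightarrow> g x + A * (norm x)\<^sup>2 = h x"
    "\<And>x. h x \<le> g x + A * (norm x)\<^sup>2" "\<And>x. g x \<le> h 0 + L * T / 8"
proof -
  have "A > 0" using assms by (simp add: A_def)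
  define z :: "('d \<Rightarrow> int) \<Rightarrow> real ^ 'd" where "z k = (\<chi> i. T * of_int (k i))" for k
  define q where "q x = h x - A * (norm x)\<^sup>2" for x
  define g where "g x = (SUP k. q (x + z k))" for x
  have q_le: "q x \<le> h 0 + L * T / 8" for x
  proof -
    \<comment> \<open>Completing the square: \<open>L * s - A * s\<^sup>2\<close> is largest at
      \<open>s = T / 4\<close>, with value \<open>L * T / 8\<close>.\<close>
    have "0 \<le> A * (norm x - T / 4)\<^sup>2" using \<open>A > 0\<close> by simp
    also have "\<dots> = A * (norm x)\<^sup>2 - L * norm x + L * T / 8"
      using \<open>T > 0\<close> by (simp add: A_def power2_diff field_simps power2_eq_square)
    finally show ?thesis using lip[of x 0] by (simp add: q_def)
  qed
  have bdd: "bdd_above (range (\<lambda>k. q (x + z k)))" for x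
    using q_le by (auto simp: bdd_above_def)
  have upper: "q (x + z k) \<le> g x" for x k unfolding g_def by (rule cSUP_upper[OF _ bdd]) simp
  have least: "g x \<le> m" if "\<And>k. q (x + z k) \<le> m" for x m
    unfolding g_def using that by (intro cSUP_least) auto
  have z0: "z (\<lambda>_. 0) = 0" by (simp add: z_def vec_eq_iff)
  have zadd: "z k + z m = z (\<lambda>i. k i + m i)" for k m by (simp add: z_def vec_eq_iff distrib_left)
  have le_shift: "g (x + z m) \<le> g x" for x m
  proof (rule least)
    fix k show "q (x + z m + z k) \<le> g x" using upper[of x "\<lambda>i. m i + k i"] by (simp add: zadd add.assoc)
  qed
  have "lattice_periodic (T / (2 * pi)) g"
  proof -
    have "g (x + z m) = g x" for x m
    proof (rule antisym[OF le_shift])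
      have "x = (x + z m) + z (\<lambda>i. - m i)" by (simp add: add.assoc zadd z0)
      then show "g x \<le> g (x + z m)" using le_shift by metis
    qed
    then show ?thesis by (simp add: lattice_periodic_def z_def)
  qed
  moreover have sc: "semiconvex A g"
    unfolding semiconvex_def
  proof (intro allI impI least)
    fix x y u v k assume uv: "0 \<le> u" "0 \<le> v" "u + v = (1::real)"
    \<comment> \<open>Each translate of \<open>q\<close> is semiconvex with the same
      \<open>A\<close>, and this property passes to suprema.\<close>
    have "semiconvex A q" unfolding semiconvex_iff_convex q_def using h by simp
    moreover have "u *\<^sub>R x + v *\<^sub>R y + z k = u *\<^sub>R (x + z k) + v *\<^sub>R (y + z k)"
      using uv(3) by (simp add: algebra_simps flip: scaleR_add_left)
    ultimately have "q (u *\<^sub>R x + v *\<^sub>R y + z k) \<le> u * q (x + z k) + v * q (y + z k)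
        + A * u * v * (norm ((x + z k) - (y + z k)))\<^sup>2"
      using uv unfolding semiconvex_def by metis
    also have "\<dots> \<le> u * g x + v * g y + A * u * v * (norm (x - y))\<^sup>2"
      using uv upper by (auto intro!: add_mono mult_left_mono)
    finally show "q (u *\<^sub>R x + v *\<^sub>R y + z k) \<le> u * g x + v * g y + A * u * v * (norm (x - y))\<^sup>2" .
  qed
  moreover have "continuous_on UNIV g"
  proof -
    have "continuous_on UNIV (\<lambda>x. g x + A * (norm x)\<^sup>2)"
      using sc unfolding semiconvex_iff_convex by (intro convex_on_continuous) auto
    then have "continuous_on UNIV (\<lambda>x. (g x + A * (norm x)\<^sup>2) - A * (norm x)\<^sup>2)"
      by (rule continuous_on_diff) (intro continuous_intros)
    then show ?thesis by simp
  qed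
  moreover have lower: "h x \<le> g x + A * (norm x)\<^sup>2" for x
    using upper[of x "\<lambda>_. 0"] by (simp add: z0 q_def)
  moreover have "g x + A * (norm x)\<^sup>2 = h x" if x: "norm x \<le> T / 4" for x
  proof (rule antisym[OF _ lower])
    have "g x \<le> h x - A * (norm x)\<^sup>2"
    proof (rule least)
      fix k
      show "q (x + z k) \<le> h x - A * (norm x)\<^sup>2"
      proof (cases "k = (\<lambda>_. 0)")
        case False
        then have zk: "T \<le> norm (z k)" unfolding z_def using \<open>T > 0\<close> by (rule lattice_norm_ge[rotated])
        \<comment> \<open>The inner product costs at most \<open>T / 2 * norm (z k)\<close> while
          the last square gives at least \<open>T * norm (z k)\<close>; multiplied by
          \<open>A\<close>, the surplus is \<open>L * norm (z k)\<close>.\<close>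
        have "(norm (x + z k))\<^sup>2 = (norm x)\<^sup>2 + 2 * (x \<bullet> z k) + (norm (z k))\<^sup>2"
          by (simp add: power2_norm_eq_inner inner_add_left inner_add_right inner_commute)
        moreover have "- (T / 4 * norm (z k)) \<le> x \<bullet> z k"
          using Cauchy_Schwarz_ineq2[of x "z k"] mult_right_mono[OF x norm_ge_zero[of "z k"]] by linarith
        moreover have "T * norm (z k) \<le> (norm (z k))\<^sup>2"
          using zk unfolding power2_eq_square by (intro mult_right_mono) auto
        ultimately have "T / 2 * norm (z k) \<le> (norm (x + z k))\<^sup>2 - (norm x)\<^sup>2" by simp
        then have "A * (T / 2 * norm (z k)) \<le> A * ((norm (x + z k))\<^sup>2 - (norm x)\<^sup>2)"
          using \<open>A > 0\<close> by (intro mult_left_mono) auto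
        moreover have "A * (T / 2 * norm (z k)) = L * norm (z k)" using \<open>T > 0\<close> by (simp add: A_def)
        moreover have "h (x + z k) \<le> h x + L * norm (z k)" using lip[of "x + z k" x] by simp
        ultimately show ?thesis unfolding q_def right_diff_distrib by linarith
      qed (simp add: z0 q_def)
    qed
    then show "g x + A * (norm x)\<^sup>2 \<le> h x" by simp
  qed
  moreover have "g x \<le> h 0 + L * T / 8" for x by (rule least) (rule q_le)
  ultimately show ?thesis using that by blast
qed

section \<open>Growth comparison and assembly of the convex polynomial approximants\<close>

lemma exp_powr_dominates:
  fixes \<alpha> c K :: real
  assumes "\<alpha> > 1"
  obtains \<rho> where "\<rho> \<ge> 0" "\<And>t. t \<ge> \<rho> \<Longrightarrow> K * exp (c * t) \<le> exp (t powr \<alpha> / 2)"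
proof -
  \<comment> \<open>Beyond \<open>\<rho>\<close> one has
    \<open>t powr (\<alpha> - 1) \<ge> s\<close>, hence
    \<open>t powr \<alpha> / 2 \<ge> (\<bar>c\<bar> + 1) * t\<close>; the extra \<open>t\<close>
    absorbs the logarithm of the factor \<open>K\<close>.\<close>
  define s where "s = max 0 (2 * (\<bar>c\<bar> + 1))"
  define \<rho> where "\<rho> = max (max 1 (ln (\<bar>K\<bar> + 1))) (s powr (1 / (\<alpha> - 1)))"
  have "K * exp (c * t) \<le> exp (t powr \<alpha> / 2)" if t: "t \<ge> \<rho>" for t
  proof -
    have t1: "t \<ge> 1" "t \<ge> ln (\<bar>K\<bar> + 1)" "t \<ge> s powr (1 / (\<alpha> - 1))" using t by (auto simp: \<rho>_def)
    have "s = (s powr (1 / (\<alpha> - 1))) powr (\<alpha> - 1)" using assms by (simp add: powr_powr s_def)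
    also have "\<dots> \<le> t powr (\<alpha> - 1)" using t1 assms by (intro powr_mono2) auto
    finally have "(\<bar>c\<bar> + 1) * t \<le> t powr (\<alpha> - 1) / 2 * t" using t1 by (intro mult_right_mono) (auto simp: s_def)
    also have "t powr (\<alpha> - 1) / 2 * t = t powr \<alpha> / 2" using t1 by (simp add: powr_diff)
    finally have *: "\<bar>c\<bar> * t + t \<le> t powr \<alpha> / 2" by (simp add: algebra_simps)
    have "c * t \<le> \<bar>c\<bar> * t" using t1 by (intro mult_right_mono) auto
    then have "ln (\<bar>K\<bar> + 1) + c * t \<le> t powr \<alpha> / 2" using * t1(2) by linarith
    then have "exp (ln (\<bar>K\<bar> + 1) + c * t) \<le> exp (t powr \<alpha> / 2)" by simp
    moreover have "exp (ln (\<bar>K\<bar> + 1) + c * t) = (\<bar>K\<bar> + 1) * exp (c * t)" by (simp add: exp_add)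
    moreover have "K * exp (c * t) \<le> (\<bar>K\<bar> + 1) * exp (c * t)" by (intro mult_right_mono) auto
    ultimately show ?thesis by linarith
  qed
  moreover have "\<rho> \<ge> 0" by (simp add: \<rho>_def)
  ultimately show ?thesis using that by blast
qed

lemma real_polynomial_function_norm_square:
  "real_polynomial_function (\<lambda>x::'a::euclidean_space. a * (norm x)\<^sup>2)"
proof -
  have "(\<lambda>x::'a. a * (norm x)\<^sup>2) = (\<lambda>x. a * (\<Sum>b\<in>Basis. (b \<bullet> x) * (b \<bullet> x)))"
    by (simp add: power2_norm_eq_inner euclidean_inner[of x x for x :: 'a] inner_commute)
  moreover have "real_polynomial_function (\<lambda>x::'a. a * (\<Sum>b\<in>Basis. (b \<bullet> x) * (b \<bullet> x)))"
    by (intro real_polynomial_function.intros(2,4) real_polynomial_function_sum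
        real_polynomial_function.intros(1) bounded_linear_inner_right) auto
  ultimately show ?thesis by simp
qed

text \<open>Once every coordinate is treated, the coefficients depend on nothing and are constants,
  so the function is a sum of cosine ridges.\<close>

lemma partial_trig_UNIV_poly_approximable:
  "partial_trig r UNIV g \<Longrightarrow> poly_approximable g"
proof (induction rule: partial_trig.induct)
  case (cosine c l \<theta>)
  have eq: "(\<lambda>x. c x * cos (l \<bullet> x + \<theta>)) = (\<lambda>x. c 0 * cos (l \<bullet> x + \<theta>))"
    using cosine(3) by (intro ext arg_cong2[where f = "(*)"]) auto
  show ?case unfolding eq by (rule poly_approximable_ridge)
qed (rule poly_approximable_add)

text \<open>\<open>C\<close> is fixed before \<open>R\<close> and \<open>\<delta>\<close>, as
  dominated convergence requires. The chain is \<open>f\<close>, its minorant \<open>h\<close>, the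
  periodized \<open>G0\<close>, the trigonometric \<open>G\<close>, and the polynomial
  \<open>P\<close>.\<close>

lemma convex_poly_approx:
  fixes f :: "real ^ 'd \<Rightarrow> real"
  assumes f: "convex_on UNIV f" and \<alpha>: "\<alpha> > 1"
  obtains C where "C \<ge> 0" "\<And>R \<delta>. \<delta> > 0 \<Longrightarrow> \<exists>n. \<exists>P \<in> convex_poly_space n.
     (\<forall>x. norm x \<le> R \<longrightarrow> \<bar>f x - P x\<bar> \<le> \<delta>) \<and>
     (\<forall>x. \<bar>f x - P x\<bar> \<le> 2 * \<bar>f x\<bar> + C * exp (norm x powr \<alpha> / 2))"
proof -
  define E where "E x = exp (norm x powr \<alpha> / 2)" for x :: "real ^ 'd"
  have E1: "1 \<le> E x" for x by (simp add: E_def)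
  have contf: "continuous_on S f" for S
    using convex_on_continuous[OF open_UNIV f] continuous_on_subset by blast
  have "\<exists>B. \<forall>z. norm z \<le> R + 1 \<longrightarrow> \<bar>f z\<bar> \<le> B" for R
  proof -
    have "bounded (f ` cball 0 (R + 1))"
      by (intro compact_imp_bounded compact_continuous_image contf compact_cball)
    then obtain b where "\<And>y. y \<in> f ` cball 0 (R + 1) \<Longrightarrow> norm y \<le> b" unfolding bounded_iff by auto
    then show ?thesis by (intro exI[of _ b]) simp
  qed
  then obtain B where B: "\<And>R z. norm z \<le> R + 1 \<Longrightarrow> \<bar>f z\<bar> \<le> B R" by metis
  \<comment> \<open>The slope of a cone below \<open>f\<close> with vertex at the origin,
    independent of \<open>R\<close>.\<close>
  define L0 where "L0 = 2 * B 0"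
  have "L0 \<ge> 0" using B[of 0 0] by (simp add: L0_def)
  have low: "f 0 - L0 * norm y \<le> f y" for y
  proof -
    have "f 0 - 2 * B 0 * norm (y - 0) \<le> f y"
      by (rule convex_lower_cone[OF f, where R = 0]) (use B[of _ 0] in simp_all)
    then show ?thesis by (simp add: L0_def)
  qed
  obtain \<rho>0 where \<rho>0: "\<rho>0 \<ge> 0" "\<And>t. t \<ge> \<rho>0 \<Longrightarrow> 1 * exp (1 * t) \<le> exp (t powr \<alpha> / 2)"
    using exp_powr_dominates[OF \<alpha>] by metis
  have norm_E: "norm x \<le> (1 + \<rho>0) * E x" for x :: "real ^ 'd"
  proof (cases "norm x \<ge> \<rho>0")
    case True
    have "norm x \<le> E x" using \<rho>0(2)[OF True] exp_ge_add_one_self[of "norm x"]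
      unfolding E_def mult_1 by linarith
    also have "\<dots> \<le> (1 + \<rho>0) * E x" using E1[of x] \<rho>0(1) by (simp add: algebra_simps)
    finally show ?thesis .
  next
    case False
    then have "norm x \<le> \<rho>0 * 1" by simp
    also have "\<dots> \<le> (1 + \<rho>0) * E x" using E1[of x] \<rho>0(1) by (intro mult_mono) auto
    finally show ?thesis .
  qed
  \<comment> \<open>The first two terms absorb the cone bound; 4 leaves room for one
    \<open>E x\<close> from each of \<open>G0_bound\<close>, \<open>G - G0\<close> and
    \<open>P - G\<close>.\<close>
  define C where "C = \<bar>f 0\<bar> + L0 * (1 + \<rho>0) + 4"
  have "C \<ge> 0" using \<open>L0 \<ge> 0\<close> \<rho>0(1) by (simp add: C_def)
  moreover have "\<exists>n. \<exists>P \<in> convex_poly_space n. (\<forall>x. norm x \<le> R \<longrightarrow> \<bar>f x - P x\<bar> \<le> \<delta>) \<and>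
     (\<forall>x. \<bar>f x - P x\<bar> \<le> 2 * \<bar>f x\<bar> + C * E x)" if "\<delta> > 0" for R \<delta> :: real
  proof -
    \<comment> \<open>The cap at 1 lets \<open>E x\<close> absorb the error, and a nonnegative
      \<open>R'\<close> puts the origin in the ball where \<open>h\<close> equals
      \<open>f\<close>.\<close>
    define \<delta>' where "\<delta>' = min \<delta> 1"
    define R' where "R' = max R 0"
    have \<delta>': "\<delta>' > 0" "\<delta>' \<le> 1" "\<delta>' \<le> \<delta>" using that by (auto simp: \<delta>'_def)
    \<comment> \<open>Steep enough for the cones at points of the ball of radius \<open>R'\<close>
      to lie below \<open>f\<close>; the summand 1 makes \<open>L\<close> positive.\<close>
    define L where "L = max L0 (2 * B R') + 1"
    have L: "L > 0" "L0 \<le> L" "2 * B R' \<le> L" using \<open>L0 \<ge> 0\<close> by (auto simp: L_def)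
    define h where "h x = (INF y. f y + L * norm (x - y))" for x
    note h = lipschitz_minorant[OF f low \<open>L0 \<ge> 0\<close> L(2), folded h_def]
    have hf: "h x = f x" if "norm x \<le> R'" for x
    proof (rule h(5))
      fix y
      have "2 * B R' * norm (y - x) \<le> L * norm (y - x)" using L by (intro mult_right_mono) auto
      moreover have "f x - 2 * B R' * norm (y - x) \<le> f y"
        by (rule convex_lower_cone[OF f _ that]) (rule B)
      ultimately show "f x - L * norm (y - x) \<le> f y" by linarith
    qed
    have h0: "h 0 = f 0" by (rule hf) (simp add: R'_def)
    define K where "K = \<bar>f 0\<bar> + 2 * L + L0"
    obtain \<rho>1 where \<rho>1: "\<rho>1 \<ge> 0" "\<And>t. t \<ge> \<rho>1 \<Longrightarrow> (2 * K) * exp (1 * t) \<le> exp (t powr \<alpha> / 2)"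
      using exp_powr_dominates[OF \<alpha>] by metis
    \<comment> \<open>The period is chosen after \<open>L\<close> and \<open>\<rho>1\<close>:
      agreement up to \<open>T / 4\<close> covers the ball of radius \<open>R'\<close>, and beyond
      \<open>T / 4\<close> the weight already beats constants depending on \<open>L\<close>.\<close>
    define T where "T = 4 * (R' + \<rho>1 + 1)"
    define A where "A = 2 * L / T"
    have T: "T > 0" "T \<ge> 2" "R' \<le> T / 4" "\<rho>1 \<le> T / 4" using \<rho>1(1) by (auto simp: T_def R'_def)
    obtain g where g: "lattice_periodic (T / (2 * pi)) g" "semiconvex A g" "continuous_on UNIV g"
      "\<And>x. norm x \<le> T / 4 \<Longrightarrow> g x + A * (norm x)\<^sup>2 = h x"
      "\<And>x. h x \<le> g x + A * (norm x)\<^sup>2" "\<And>x. g x \<le> h 0 + L * T / 8"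
      using convex_periodization[OF h(1) h(2) L(1) T(1)] unfolding A_def by blast
    define G0 where "G0 x = g x + A * (norm x)\<^sup>2" for x
    \<comment> \<open>\<open>L\<close> must not appear here. Inside \<open>T / 4\<close>,
      \<open>G0 = h\<close> lies between the fixed cone and \<open>f\<close>; outside, quadratic
      growth with factor \<open>K\<close> is swallowed by \<open>E x\<close>.\<close>
    have G0_bound: "\<bar>G0 x\<bar> \<le> \<bar>f x\<bar> + \<bar>f 0\<bar> + L0 * norm x + E x" for x
    proof (cases "norm x \<le> T / 4")
      case True
      have "0 \<le> L0 * norm x" using \<open>L0 \<ge> 0\<close> by simp
      then show ?thesis using g(4)[OF True] h(3,4)[of x] E1[of x] unfolding G0_def by linarith
    next
      case False
      let ?t = "norm x"
      have "A \<le> L" using T L by (simp add: A_def field_simps)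
      then have "A * ?t\<^sup>2 \<le> L * ?t\<^sup>2" by (intro mult_right_mono) auto
      moreover have "L * T / 8 \<le> L * ?t"
      proof -
        have "L * (T / 8) \<le> L * ?t" using False L(1) T(1) by (intro mult_left_mono) auto
        then show ?thesis by simp
      qed
      ultimately have "G0 x \<le> \<bar>f 0\<bar> + L * ?t + L * ?t\<^sup>2"
        using g(6)[of x] unfolding G0_def h0 by linarith
      moreover have "- G0 x \<le> \<bar>f 0\<bar> + L0 * ?t" using g(5)[of x] h(3)[of x] unfolding G0_def by linarith
      moreover have "0 \<le> L0 * ?t" "0 \<le> L * ?t" "0 \<le> L * ?t\<^sup>2" using \<open>L0 \<ge> 0\<close> L by auto
      ultimately have "\<bar>G0 x\<bar> \<le> \<bar>f 0\<bar> + (L + L0) * ?t + L * ?t\<^sup>2"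
        unfolding distrib_right by linarith
      also have "\<dots> \<le> K * 1 + K * ?t + K * ?t\<^sup>2"
        using L \<open>L0 \<ge> 0\<close> by (intro add_mono mult_right_mono) (auto simp: K_def)
      also have "\<dots> = K * (1 + ?t + ?t\<^sup>2)" by (simp add: distrib_left)
      also have "\<dots> \<le> K * (2 * exp ?t)"
      proof (rule mult_left_mono)
        show "1 + ?t + ?t\<^sup>2 \<le> 2 * exp ?t"
          using exp_lower_Taylor_quadratic[OF norm_ge_zero[of x]] norm_ge_zero[of x] by linarith
        show "0 \<le> K" using L \<open>L0 \<ge> 0\<close> by (simp add: K_def)
      qed
      also have "\<dots> \<le> E x" using \<rho>1(2)[of ?t] False T(4) by (simp add: E_def)
      finally show ?thesis using \<open>0 \<le> L0 * ?t\<close> by linarith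
    qed
    obtain g' where g': "semiconvex A g'" "partial_trig (T / (2 * pi)) UNIV g'"
      "\<And>x. \<bar>g' x - g x\<bar> \<le> \<delta>' / 2"
      using semiconvex_partial_trig_approx[OF g(3,1,2), of UNIV "\<delta>' / 2"] T(1) \<delta>'(1) by auto
    define G where "G x = g' x + A * (norm x)\<^sup>2" for x
    have "convex_on UNIV G" using g'(1) unfolding semiconvex_iff_convex G_def .
    have GG0: "\<bar>G x - G0 x\<bar> \<le> \<delta>' / 2" for x using g'(3)[of x] by (simp add: G_def G0_def)
    have "poly_approximable G"
      unfolding G_def by (intro poly_approximable_add partial_trig_UNIV_poly_approximable[OF g'(2)]
          poly_approximable_polynomial real_polynomial_function_norm_square)
    then obtain K' c where K': "poly_approximable_within K' c G" unfolding poly_approximable_def by auto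
    obtain \<rho>2 where \<rho>2: "\<rho>2 \<ge> 0" "\<And>t. t \<ge> \<rho>2 \<Longrightarrow> K' * exp (c * t) \<le> exp (t powr \<alpha> / 2)"
      using exp_powr_dominates[OF \<alpha>] by metis
    have "\<delta>' / 2 > 0" using \<delta>'(1) by simp
    \<comment> \<open>Accuracy extends to radius \<open>\<rho>2\<close>, past which \<open>E\<close>
      dominates the exponential error; so \<open>P - G\<close> is bounded by \<open>E\<close>
      everywhere.\<close>
    obtain P where P: "real_polynomial_function P" "convex_on UNIV (\<lambda>x. P x - G x)"
      "\<And>x. \<bar>P x - G x\<bar> \<le> K' * exp (c * norm x)"
      "\<And>x. norm x \<le> max R' \<rho>2 \<Longrightarrow> \<bar>P x - G x\<bar> \<le> \<delta>' / 2"
      using poly_approximable_withinE[OF K' \<open>\<delta>' / 2 > 0\<close>, of "max R' \<rho>2"] by metis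
    have "convex_on UNIV P" using convex_on_add[OF P(2) \<open>convex_on UNIV G\<close>] by simp
    moreover obtain n where "P \<in> poly_space n" using real_polynomial_function_poly_space[OF P(1)] by auto
    ultimately have "P \<in> convex_poly_space n" by (simp add: convex_poly_space_def)
    moreover have "\<bar>f x - P x\<bar> \<le> \<delta>" if "norm x \<le> R" for x
    proof -
      have x: "norm x \<le> R'" using that by (simp add: R'_def)
      have "G0 x = f x" using g(4)[of x] hf[OF x] x T(3) by (simp add: G0_def)
      moreover have "\<bar>P x - G x\<bar> \<le> \<delta>' / 2" using x by (intro P(4)) simp
      ultimately show ?thesis using GG0[of x] \<delta>'(3) by linarith
    qed
    moreover have "\<bar>f x - P x\<bar> \<le> 2 * \<bar>f x\<bar> + C * E x" for x
    proof -
      have "\<bar>P x - G x\<bar> \<le> E x"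
      proof (cases "norm x \<le> \<rho>2")
        case True
        then have "\<bar>P x - G x\<bar> \<le> \<delta>' / 2" by (intro P(4)) simp
        then show ?thesis using E1[of x] \<delta>'(2) by linarith
      next
        case False
        then show ?thesis using P(3)[of x] \<rho>2(2)[of "norm x"] unfolding E_def by linarith
      qed
      moreover have "\<bar>G x - G0 x\<bar> \<le> E x" using GG0[of x] \<delta>'(2) E1[of x] by linarith
      moreover have "L0 * norm x \<le> L0 * (1 + \<rho>0) * E x"
        using mult_left_mono[OF norm_E[of x] \<open>L0 \<ge> 0\<close>] by (simp add: mult.assoc)
      moreover have "\<bar>f 0\<bar> \<le> \<bar>f 0\<bar> * E x" using mult_left_mono[OF E1[of x], of "\<bar>f 0\<bar>"] by simp
      moreover have "C * E x = \<bar>f 0\<bar> * E x + L0 * (1 + \<rho>0) * E x + 4 * E x"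
        by (simp add: C_def algebra_simps)
      ultimately show ?thesis using G0_bound[of x] E1[of x] by linarith
    qed
    ultimately show ?thesis by blast
  qed
  ultimately show ?thesis using that unfolding E_def by blast
qed

section \<open>Convergence in the weighted norm\<close>

lemma nn_integral_inverse_1_plus_square: "(\<integral>\<^sup>+x. ennreal (inverse (1 + x\<^sup>2)) \<partial>lborel) < \<infinity>"
proof -
  have "integrable lborel (\<lambda>x::real. inverse (1 + x\<^sup>2))"
    using integrable_inverse_1_plus_square by (simp add: set_integrable_def)
  then show ?thesis unfolding integrable_iff_bounded by simp
qed

text \<open>Comparison with the product of \<open>1 / (1 + (x \<bullet> b)\<^sup>2)\<close> over the
  coordinates, whose integral factors into finite one-dimensional ones.\<close>

lemma nn_integral_exp_powr:
  fixes \<alpha> :: real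
  assumes "\<alpha> > 1"
  shows "(\<integral>\<^sup>+x. ennreal (exp (- (norm (x :: real ^ 'd) powr \<alpha> / 2))) \<partial>lborel) < \<infinity>"
proof -
  define D where "D = DIM(real ^ 'd)"
  obtain \<rho> where \<rho>: "\<rho> \<ge> 0" "\<And>t. t \<ge> \<rho> \<Longrightarrow> 2 ^ D * exp (real D * t) \<le> exp (t powr \<alpha> / 2)"
    using exp_powr_dominates[OF assms] by metis
  define K where "K = 2 ^ D * exp (real D * \<rho>)"
  have "K \<ge> 1" using \<rho>(1) by (simp add: K_def mult_ge1_I)
  have prod_le: "(\<Prod>b\<in>Basis. 1 + (x \<bullet> b)\<^sup>2) \<le> K * exp (norm x powr \<alpha> / 2)" for x :: "real ^ 'd"
  proof -
    have "(x \<bullet> b)\<^sup>2 \<le> (norm x)\<^sup>2" if "b \<in> Basis" for b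
      using Basis_le_norm[OF that, of x] power_mono[of "\<bar>x \<bullet> b\<bar>" "norm x" 2] by simp
    then have "1 + (x \<bullet> b)\<^sup>2 \<le> 2 * exp (norm x)" if "b \<in> Basis" for b
      using exp_lower_Taylor_quadratic[of "norm x"] norm_ge_zero[of x] that by (smt (verit) field_sum_of_halves)
    then have "(\<Prod>b\<in>Basis. 1 + (x \<bullet> b)\<^sup>2) \<le> (\<Prod>b\<in>(Basis :: (real ^ 'd) set). 2 * exp (norm x))"
      by (intro prod_mono) auto
    also have "\<dots> = 2 ^ D * exp (real D * norm x)"
      by (simp add: D_def power_mult_distrib exp_of_nat_mult)
    also have "\<dots> \<le> K * exp (norm x powr \<alpha> / 2)"
    proof (cases "norm x \<ge> \<rho>")
      case True
      then have "2 ^ D * exp (real D * norm x) \<le> 1 * exp (norm x powr \<alpha> / 2)" using \<rho>(2) by simp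
      also have "\<dots> \<le> K * exp (norm x powr \<alpha> / 2)" using \<open>K \<ge> 1\<close> by (intro mult_right_mono) auto
      finally show ?thesis .
    next
      case False
      then have "2 ^ D * exp (real D * norm x) \<le> K * 1" by (simp add: K_def mult_left_mono)
      also have "\<dots> \<le> K * exp (norm x powr \<alpha> / 2)" using \<open>K \<ge> 1\<close> by (intro mult_left_mono) auto
      finally show ?thesis .
    qed
    finally show ?thesis .
  qed
  have "ennreal (exp (- (norm x powr \<alpha> / 2))) \<le> ennreal K * (\<Prod>b\<in>Basis. ennreal (inverse (1 + (x \<bullet> b)\<^sup>2)))"
    for x :: "real ^ 'd"
  proof -
    have pos: "0 < (\<Prod>b\<in>Basis. 1 + (x \<bullet> b)\<^sup>2)" by (intro prod_pos) (auto intro: add_pos_nonneg)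
    have "exp (- (norm x powr \<alpha> / 2)) \<le> K * inverse (\<Prod>b\<in>Basis. 1 + (x \<bullet> b)\<^sup>2)"
      using prod_le[of x] pos by (simp add: exp_minus field_simps)
    also have "inverse (\<Prod>b\<in>Basis. 1 + (x \<bullet> b)\<^sup>2) = (\<Prod>b\<in>Basis. inverse (1 + (x \<bullet> b)\<^sup>2))"
      by (simp add: prod_inversef[symmetric] comp_def)
    finally show ?thesis
      using \<open>K \<ge> 1\<close> by (subst prod_ennreal) (auto simp flip: ennreal_mult simp: prod_nonneg intro!: ennreal_leI)
  qed
  then have "(\<integral>\<^sup>+x. ennreal (exp (- (norm (x :: real ^ 'd) powr \<alpha> / 2))) \<partial>lborel)
      \<le> (\<integral>\<^sup>+x. ennreal K * (\<Prod>b\<in>Basis. ennreal (inverse (1 + ((x :: real ^ 'd) \<bullet> b)\<^sup>2))) \<partial>lborel)"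
    by (intro nn_integral_mono) auto
  also have "\<dots> = ennreal K * (\<Prod>b\<in>(Basis :: (real ^ 'd) set). \<integral>\<^sup>+x. ennreal (inverse (1 + x\<^sup>2)) \<partial>lborel)"
    by (subst nn_integral_cmult, measurable) (subst nn_integral_lborel_prod, auto)
  also have "\<dots> < \<infinity>"
    using nn_integral_inverse_1_plus_square by (auto intro!: ennreal_mult_less_top[THEN iffD2] simp: power_less_top_ennreal)
  finally show ?thesis .
qed

lemma W_nonneg_le_1: "0 \<le> W \<alpha> x" "W \<alpha> x \<le> 1"
  by (auto simp: W_def)

lemma abs_W [simp]: "\<bar>W \<alpha> x\<bar> = W \<alpha> x"
  by (simp add: W_def)

lemma borel_measurable_W [measurable]: "W \<alpha> \<in> borel_measurable borel"
  unfolding W_def[abs_def] by measurable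

text \<open>Half of the exponent of the weight pays for the growth of the approximants; the other
  half remains as an integrable function vanishing at infinity.\<close>

lemma exp_half_mult_W: "exp (norm x powr \<alpha> / 2) * W \<alpha> x = exp (- (norm x powr \<alpha> / 2))"
  by (simp add: W_def flip: exp_add)

text \<open>The sum is at most twice the larger summand.\<close>

lemma powr_sum_le:
  fixes a b q :: real
  assumes "0 \<le> a" "0 \<le> b" "0 \<le> q"
  shows "(a + b) powr q \<le> (2 * a) powr q + (2 * b) powr q"
proof (cases "a \<le> b")
  case True
  then have "(a + b) powr q \<le> (2 * b) powr q" using assms by (intro powr_mono2) auto
  then show ?thesis by (simp add: add_increasing)
next
  case False
  then have "(a + b) powr q \<le> (2 * a) powr q" using assms by (intro powr_mono2) auto
  then show ?thesis by (simp add: add_increasing2)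
qed

lemma tendsto_ennpow_0:
  assumes "(X \<longlongrightarrow> 0) F" "q > 0"
  shows "((\<lambda>n. ennpow (X n) q) \<longlongrightarrow> 0) F"
proof -
  \<comment> \<open>Eventual finiteness removes the separate case of \<open>ennpow\<close> at
    infinity.\<close>
  have "\<forall>\<^sub>F n in F. X n < 1" using assms(1) by (rule order_tendstoD) simp
  then have "\<forall>\<^sub>F n in F. ennreal (enn2real (X n) powr q) = ennpow (X n) q"
    by eventually_elim (auto simp: ennpow_def)
  moreover have "((\<lambda>n. ennreal (enn2real (X n) powr q)) \<longlongrightarrow> ennreal 0) F"
  proof (intro tendsto_ennrealI tendsto_zero_powrI[where b = q] tendsto_const assms)
    have "((\<lambda>n. enn2real (X n)) \<longlongrightarrow> enn2real 0) F" by (rule tendsto_enn2real) (use assms in auto)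
    then show "((\<lambda>n. enn2real (X n)) \<longlongrightarrow> 0) F" by simp
  qed auto
  ultimately show ?thesis by (simp add: tendsto_cong)
qed

theorem theorem1:
  fixes f :: "real ^ 'd \<Rightarrow> real" and p :: ennreal and \<alpha> :: real
  assumes "1 \<le> p" and "\<alpha> > 1"
    and "convex_on UNIV f"
    and "p \<noteq> \<infinity> \<Longrightarrow> (\<lambda>x. f x * W \<alpha> x) \<in> borel_measurable lborel
                        \<and> Lp_norm p (\<lambda>x. f x * W \<alpha> x) < \<infinity>"
    and "p = \<infinity> \<Longrightarrow> continuous_on UNIV f \<and> ((\<lambda>x. f x * W \<alpha> x) \<longlongrightarrow> 0) at_infinity"
  shows "(\<lambda>n. INF P \<in> convex_poly_space n. Lp_norm p (\<lambda>x. (f x - P x) * W \<alpha> x))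
           \<longlonglongrightarrow> 0"
proof -
  define e where "e x = exp (- (norm x powr \<alpha> / 2))" for x :: "real ^ 'd"
  have e: "0 \<le> e x" "e x \<le> 1" for x by (auto simp: e_def)
  have meas: "g \<in> borel_measurable borel" if "convex_on UNIV g" for g :: "real ^ 'd \<Rightarrow> real"
    using convex_on_continuous[OF open_UNIV that] by (rule borel_measurable_continuous_onI)
  note [measurable] = meas[OF assms(3)]
  obtain C where C: "C \<ge> 0" "\<And>R \<delta>. \<delta> > 0 \<Longrightarrow> \<exists>n. \<exists>P \<in> convex_poly_space n.
     (\<forall>x. norm x \<le> R \<longrightarrow> \<bar>f x - P x\<bar> \<le> \<delta>) \<and>
     (\<forall>x. \<bar>f x - P x\<bar> \<le> 2 * \<bar>f x\<bar> + C * exp (norm x powr \<alpha> / 2))"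
    using convex_poly_approx[OF assms(3,2)] by metis
  \<comment> \<open>One sequence serves every \<open>p\<close>: the radius grows, the error shrinks,
    and the domination is uniform in \<open>n\<close>. The index \<open>n\<close> is unrelated to
    the degree \<open>N\<close>.\<close>
  have "\<exists>P. (\<exists>N. P \<in> convex_poly_space N) \<and> (\<forall>x. norm x \<le> real n \<longrightarrow> \<bar>f x - P x\<bar> \<le> inverse (real (Suc n))) \<and>
     (\<forall>x. \<bar>f x - P x\<bar> \<le> 2 * \<bar>f x\<bar> + C * exp (norm x powr \<alpha> / 2))" for n
    using C(2)[of "inverse (real (Suc n))" "real n"] by auto
  then obtain P where P: "\<And>n. \<exists>N. P n \<in> convex_poly_space N"
    "\<And>n x. norm x \<le> real n \<Longrightarrow> \<bar>f x - P n x\<bar> \<le> inverse (real (Suc n))"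
    "\<And>n x. \<bar>f x - P n x\<bar> \<le> 2 * \<bar>f x\<bar> + C * exp (norm x powr \<alpha> / 2)"
    by metis
  have [measurable]: "P n \<in> borel_measurable borel" for n
    using P(1)[of n] by (intro meas) (auto simp: convex_poly_space_def)
  define D where "D n x = \<bar>(f x - P n x) * W \<alpha> x\<bar>" for n x
  have near: "D n x \<le> inverse (real (Suc n))" if "norm x \<le> real n" for n x
  proof -
    have "D n x = \<bar>f x - P n x\<bar> * W \<alpha> x" by (simp add: D_def abs_mult)
    also have "\<dots> \<le> \<bar>f x - P n x\<bar> * 1" by (intro mult_left_mono W_nonneg_le_1) auto
    finally show ?thesis using P(2)[OF that] by simp
  qed
  have dom: "D n x \<le> 2 * \<bar>f x * W \<alpha> x\<bar> + C * e x" for n x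
  proof -
    have "D n x = \<bar>f x - P n x\<bar> * W \<alpha> x" by (simp add: D_def abs_mult)
    also have "\<dots> \<le> (2 * \<bar>f x\<bar> + C * exp (norm x powr \<alpha> / 2)) * W \<alpha> x"
      by (intro mult_right_mono P W_nonneg_le_1)
    also have "\<dots> = 2 * \<bar>f x * W \<alpha> x\<bar> + C * e x"
      by (simp add: distrib_right abs_mult e_def mult.assoc exp_half_mult_W)
    finally show ?thesis .
  qed
  have lim: "(\<lambda>n. Lp_norm p (\<lambda>x. (f x - P n x) * W \<alpha> x)) \<longlonglongrightarrow> 0"
  proof (cases "p = \<infinity>")
    case True
    \<comment> \<open>The dominating function vanishes at infinity, so it controls the outside of
      the ball of radius \<open>n\<close>, while \<open>near\<close> controls the inside.\<close>
    have "((\<lambda>x. 2 * \<bar>f x * W \<alpha> x\<bar> + C * e x) \<longlongrightarrow> 2 * \<bar>0\<bar> + C * 0) at_infinity"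
    proof (intro tendsto_intros)
      show "((\<lambda>x. f x * W \<alpha> x) \<longlongrightarrow> 0) at_infinity" using assms(5) True by simp
      have "((\<lambda>t. exp (- (t powr \<alpha> / 2))) \<longlongrightarrow> 0) at_top" using assms(2) by real_asymp
      from filterlim_compose[OF this filterlim_norm_at_top]
      show "(e \<longlongrightarrow> 0) at_infinity" unfolding e_def .
    qed
    then have far: "((\<lambda>x. 2 * \<bar>f x * W \<alpha> x\<bar> + C * e x) \<longlongrightarrow> 0) at_infinity" by simp
    show ?thesis
    proof (rule order_tendstoI)
      fix \<epsilon> :: ennreal assume "0 < \<epsilon>"
      then obtain s where s: "0 < s" "s < \<epsilon>" using dense by blast
      then obtain r where r: "s = ennreal r" "0 < r"
        by (cases s) (auto simp: ennreal_less_zero_iff)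
      have "\<forall>\<^sub>F x in at_infinity. 2 * \<bar>f x * W \<alpha> x\<bar> + C * e x < r"
        using far r(2) by (rule order_tendstoD)
      then obtain b where b: "\<And>x. b \<le> norm x \<Longrightarrow> 2 * \<bar>f x * W \<alpha> x\<bar> + C * e x < r"
        unfolding eventually_at_infinity by auto
      have "\<forall>\<^sub>F n in sequentially. inverse (real (Suc n)) < r"
        using LIMSEQ_inverse_real_of_nat r(2) by (rule order_tendstoD)
      moreover have "\<forall>\<^sub>F n in sequentially. b \<le> real n"
        by (rule eventually_sequentiallyI[of "nat \<lceil>b\<rceil>"]) linarith
      ultimately show "\<forall>\<^sub>F n in sequentially. Lp_norm p (\<lambda>x. (f x - P n x) * W \<alpha> x) < \<epsilon>"
      proof eventually_elim
        case (elim n)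
        have "D n x \<le> r" for x
        proof (cases "norm x \<le> real n")
          case True
          then show ?thesis using near[OF True] elim(1) by linarith
        next
          case False
          then show ?thesis using dom[of n x] b[of x] elim(2) by linarith
        qed
        then have "esssup lborel (\<lambda>x. ennreal (D n x)) \<le> ennreal r"
          by (intro esssup_I) (auto simp: D_def intro: ennreal_leI)
        then show ?case using True s r by (simp add: Lp_norm_def D_def)
      qed
    qed simp
  next
    case False
    define q where "q = enn2real p"
    have q: "q \<ge> 1" using assms(1) False enn2real_mono[of 1 p] by (simp add: q_def less_top)
    have Lp: "Lp_norm p g = ennpow (\<integral>\<^sup>+x. ennreal (\<bar>g x\<bar> powr q) \<partial>lborel) (1 / q)" for g :: "real ^ 'd \<Rightarrow> real"
      using False by (simp add: Lp_norm_def q_def)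
    have fin: "(\<integral>\<^sup>+x. ennreal (\<bar>f x * W \<alpha> x\<bar> powr q) \<partial>lborel) < \<infinity>"
      using assms(4)[OF False] unfolding Lp by (auto simp: ennpow_def less_top split: if_splits)
    \<comment> \<open>The factor 4 combines the 2 of \<open>dom\<close> with the 2 of
      \<open>powr_sum_le\<close>; \<open>e x\<close> appears to the first power because
      \<open>e x \<le> 1\<close> and \<open>q \<ge> 1\<close>.\<close>
    define w where "w x = ennreal (4 powr q) * ennreal (\<bar>f x * W \<alpha> x\<bar> powr q) + ennreal ((2 * C) powr q) * ennreal (e x)" for x
    have [measurable]: "e \<in> borel_measurable borel" unfolding e_def[abs_def] by measurable
    have D_le_w: "ennreal (D n x powr q) \<le> w x" for n x
    proof -
      have "D n x powr q \<le> (2 * \<bar>f x * W \<alpha> x\<bar> + C * e x) powr q"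
        using dom q by (intro powr_mono2) (auto simp: D_def)
      also have "\<dots> \<le> (2 * (2 * \<bar>f x * W \<alpha> x\<bar>)) powr q + (2 * (C * e x)) powr q"
        using q C(1) e by (intro powr_sum_le) auto
      also have "(2 * (2 * \<bar>f x * W \<alpha> x\<bar>)) powr q = 4 powr q * \<bar>f x * W \<alpha> x\<bar> powr q"
        using powr_mult[of 4 "\<bar>f x * W \<alpha> x\<bar>" q] by simp
      also have "(2 * (C * e x)) powr q = (2 * C) powr q * e x powr q"
        using powr_mult[of "2 * C" "e x" q] C(1) e by (simp add: mult.assoc)
      also have "\<dots> \<le> (2 * C) powr q * e x"
        using powr_mono'[of 1 q "e x"] q e by (intro mult_left_mono) auto
      finally show ?thesis
        unfolding w_def using e C(1) by (simp flip: ennreal_mult ennreal_plus add: ennreal_leI)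
    qed
    have "(\<lambda>n. \<integral>\<^sup>+x. ennreal (D n x powr q) \<partial>lborel) \<longlonglongrightarrow> (\<integral>\<^sup>+(x::real^'d). 0 \<partial>lborel)"
    proof (rule nn_integral_dominated_convergence)
      show "(\<lambda>x. ennreal (D n x powr q)) \<in> borel_measurable lborel" for n
        unfolding D_def by measurable
      show "w \<in> borel_measurable lborel" unfolding w_def[abs_def] by measurable
      show "AE x in lborel. ennreal (D n x powr q) \<le> w x" for n using D_le_w by simp
      have "(\<integral>\<^sup>+x. w x \<partial>lborel) = ennreal (4 powr q) * (\<integral>\<^sup>+x. ennreal (\<bar>f x * W \<alpha> x\<bar> powr q) \<partial>lborel)
          + ennreal ((2 * C) powr q) * (\<integral>\<^sup>+x. ennreal (e x) \<partial>lborel)"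
        unfolding w_def by (subst nn_integral_add, measurable) (simp add: nn_integral_cmult)
      also have "\<dots> < \<infinity>"
        using fin nn_integral_exp_powr[OF assms(2), where 'd = 'd] by (simp add: e_def ennreal_mult_less_top)
      finally show "(\<integral>\<^sup>+x. w x \<partial>lborel) < \<infinity>" .
      have "(\<lambda>n. ennreal (D n x powr q)) \<longlonglongrightarrow> 0" for x
      proof (rule tendsto_sandwich[OF _ _ tendsto_const])
        show "\<forall>\<^sub>F n in sequentially. 0 \<le> ennreal (D n x powr q)" by simp
        obtain N where N: "norm x \<le> real N" using real_arch_simple by auto
        show "\<forall>\<^sub>F n in sequentially. ennreal (D n x powr q) \<le> ennreal (inverse (real (Suc n)))"
          using eventually_ge_at_top[of N]
        proof eventually_elim
          case (elim n)
          then have D: "D n x \<le> inverse (real (Suc n))" using N by (intro near) linarith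
          have D0: "0 \<le> D n x" by (simp add: D_def)
          have "inverse (real (Suc n)) \<le> 1" by (simp add: inverse_le_1_iff)
          with D D0 have "D n x powr q \<le> D n x powr 1" using q by (intro powr_mono') auto
          then show ?case using D D0 by (intro ennreal_leI) simp
        qed
        show "(\<lambda>n. ennreal (inverse (real (Suc n)))) \<longlonglongrightarrow> 0"
          using tendsto_ennrealI[OF LIMSEQ_inverse_real_of_nat] by simp
      qed
      then show "AE x in lborel. (\<lambda>n. ennreal (D n x powr q)) \<longlonglongrightarrow> 0" by simp
    qed simp
    then have "(\<lambda>n. \<integral>\<^sup>+x. ennreal (D n x powr q) \<partial>lborel) \<longlonglongrightarrow> 0" by simp
    then show ?thesis unfolding Lp D_def using q by (intro tendsto_ennpow_0) auto
  qed
  show ?thesis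
  proof (rule order_tendstoI)
    fix \<epsilon> :: ennreal assume "0 < \<epsilon>"
    then have "\<forall>\<^sub>F n in sequentially. Lp_norm p (\<lambda>x. (f x - P n x) * W \<alpha> x) < \<epsilon>"
      using lim by (intro order_tendstoD)
    then obtain n where n: "Lp_norm p (\<lambda>x. (f x - P n x) * W \<alpha> x) < \<epsilon>"
      unfolding eventually_sequentially by auto
    \<comment> \<open>The spaces increase with the degree, so a single good polynomial bounds the
      infimum for all \<open>m \<ge> N\<close>.\<close>
    obtain N where N: "P n \<in> convex_poly_space N" using P(1) by auto
    show "\<forall>\<^sub>F m in sequentially. (INF P \<in> convex_poly_space m. Lp_norm p (\<lambda>x. (f x - P x) * W \<alpha> x)) < \<epsilon>"
      using eventually_ge_at_top[of N]
    proof eventually_elim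
      case (elim m)
      then have "P n \<in> convex_poly_space m" using N convex_poly_space_mono by blast
      then have "(INF P \<in> convex_poly_space m. Lp_norm p (\<lambda>x. (f x - P x) * W \<alpha> x))
          \<le> Lp_norm p (\<lambda>x. (f x - P n x) * W \<alpha> x)" by (rule INF_lower)
      then show ?case using n by (rule le_less_trans)
    qed
  qed simp
qed

end
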